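(* Let $P$ be a super-consistent (disjunctive) ASP program and let $Q = g(\bar t)?$ be a query (every constant of $g(\bar t)$ appears in $P$). Let $\mathrm{DMS}(Q,P)$ be the program produced by the Dynamic Magic Set rewriting of $P$ w.r.t. $Q$ (described in the context), for any fixed choice of SIPS. Then $\mathrm{DMS}(Q,P)$ and $P$ are both brave-equivalent and cautious-equivalent w.r.t. $Q$.
   Context: Syntax. A term is a variable or a constant. An atom is $p(t_1,\dots,t_k)$ with $p$ a predicate of arity $k\ge 0$ and $t_i$ terms. A rule $r$ has the form $p_1(\bar t_1)\vee\cdots\vee p_n(\bar t_n) \leftarrow q_1(\bar s_1),\dots,q_j(\bar s_j),\ \mathit{not}\ q_{j+1}(\bar s_{j+1}),\dots,\mathit{not}\ q_m(\bar s_m)$ with $n\ge1$, $m\ge j\ge 0$; $H(r)$ is the set of head atoms, $B^+(r)=\{q_1(\bar s_1),\dots,q_j(\bar s_j)\}$, $B^-(r)=\{q_{j+1}(\bar s_{j+1}),\dots,q_m(\bar s_m)\}$, and $\mathrm{atoms}(r)=H(r)\cup B^+(r)\cup B^-(r)$. A fact is a rule with empty body, exactly one head atom and no variables. A program is a finite set of rules. A predicate $p$ is EDB in $P$ if all rules of $P$ having a $p$-atom in the head are facts, and IDB otherwise; $\mathrm{EDB}(P)$ is the set of rules of $P$ having no IDB predicate in the head. Semantics. $U_P$ is the set of constants of $P$ (one arbitrary constant if there are none); $B_P$ is the set of ground atoms built from predicates of $P$ and constants of $U_P$; $\mathrm{ground}(P)$ is the set of all ground instances of rules of $P$ obtained by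 substituting constants of $U_P$ for variables. An interpretation $I\subseteq B_P$ is a model of $P$ if for every $r\in\mathrm{ground}(P)$ with $B^+(r)\subseteq I$ and $B^-(r)\cap I=\emptyset$ we have $H(r)\cap I\neq\emptyset$. The reduct $\mathrm{ground}(P)^I$ is obtained from $\mathrm{ground}(P)$ by deleting every rule $r$ with $B^-(r)\cap I\ne\emptyset$ and removing all negative literals from the remaining rules. $M$ is an answer set of $P$ iff $M$ is a subset-minimal model of $\mathrm{ground}(P)^M$. A program $P$ is super-consistent if $P\cup F$ has at least one answer set for every set of facts $F$. Queries. A query $Q=g(\bar t)?$ is an atom. $\mathrm{Ans}_c(Q,P)$ (resp. $\mathrm{Ans}_b(Q,P)$) is the set of substitutions $\vartheta$ of the variables of $g(\bar t)$ by constants such that $g(\bar t)\vartheta$ belongs to every (resp. some) answer set of $P$. Programs $P,P'$ are cautious-equivalent (resp. brave-equivalent) w.r.t. $Q$ if $\mathrm{Ans}_c(Q,P\cup F)=\mathrm{Ans}_c(Q,P'\cup F)$ (resp. $\mathrm{Ans}_b(Q,P\cup F)=\mathrm{Ans}_b(Q,P'\cup F)$) for every set of facts $F$ over the EDB predicates of $P$ and $P'$. Adornments. An adornment of a $k$-ary predicate $p$ is a string $\alpha\in\{b,f\}^k$; $p^\alpha$ is a new (adorned) predicate symbol. For an adorned atom $p^\alpha(\bar t)$, its magic version $\mathrm{magic}(p^\alpha(\bar t))$ is the atom $\mathit{magic\_p}^\alpha(\bar t')$, where $\mathit{magic\_p}^\alpha$ is a fresh predicate and $\bar t'$ is obtained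 from $\bar t$ by deleting the arguments at positions where $\alpha$ has $f$. SIPS. For a rule $r$, an atom $p(\bar t)\in H(r)$ and an adornment $\alpha$ of $p$, a SIPS is a pair $(\prec,f)$ where $\prec$ is a strict partial order on $\mathrm{atoms}(r)$ such that (a) $p(\bar t)\prec q(\bar s)$ for every $q(\bar s)\in\mathrm{atoms}(r)$ different from $p(\bar t)$, and (b) no atom of $(H(r)\setminus\{p(\bar t)\})\cup B^-(r)$ precedes any atom; and $f$ assigns to each atom $q(\bar s)\in\mathrm{atoms}(r)$ a subset of the variables of $\bar s$ (the variables made bound when processing it; for $p(\bar t)$, the variables at positions bound by $\alpha$). A SIPS is fixed for every such triple $(r,p(\bar t),\alpha)$. Adorned rule. Given $r$, $p(\bar t)\in H(r)$ and $\alpha$, the adorned rule $r^a$ replaces $p(\bar t)$ by $p^\alpha(\bar t)$ and every other atom $q(\bar s)$ of $r$ whose predicate is IDB in $P$ by $q^\beta(\bar s)$, where the $i$-th symbol of $\beta$ is $b$ iff the $i$-th argument of $\bar s$ is a constant or a variable $X$ with $X\in f(p(\bar t))$ or $X\in f(b(\bar z))$ for some $b(\bar z)\in B^+(r)$ with $b(\bar z)\prec q(\bar s)$, and $f$ otherwise; EDB atoms are not adorned. Magic rules. For each adorned atom $q^\beta(\bar s)$ of $r^a$ other than $p^\alpha(\bar t)$, a magic rule is generated with head $\mathrm{magic}(q^\beta(\bar s))$ and body consisting of $\mathrm{magic}(p^\alpha(\bar t))$ together with all (unadorned) atoms $b(\bar z)\in\mathrm{atoms}(r)\setminus\{p(\bar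 t)\}$ with $b(\bar z)\prec q(\bar s)$. Modified rule. The modified rule is obtained from $r$ by adding to its body the atom $\mathrm{magic}(h^\gamma(\bar u))$ for every head atom $h^\gamma(\bar u)$ of $r^a$. Algorithm $\mathrm{DMS}$. Start with the magic seed fact $\mathrm{magic}(g^\alpha(\bar t))$, where $\alpha$ has $b$ exactly at the positions of $\bar t$ holding constants, and with the set $S=\{g^\alpha\}$ of pending adorned predicates. While $S\ne\emptyset$: remove some $p^\alpha$ from $S$; for each rule $r\in P$ and each atom $p(\bar t)\in H(r)$ with predicate $p$, build $r^a$, collect its magic rules and its modified rule, and insert into $S$ every adorned predicate occurring in $r^a$ that has not been inserted before. Finally $\mathrm{DMS}(Q,P)$ is the set consisting of the magic seed, all collected magic rules, all collected modified rules, and $\mathrm{EDB}(P)$.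
   Formalization: It is additionally assumed that P is safe (every variable of a rule occurs in its positive body) or that every constant of P still occurs in DMS(Q,P); otherwise the claim fails, e.g. for P = {g(X) ←; h(c) ← e(d)} with query g(X)?. *)

theory Defs
  imports "HOL-Library.FuncSet"
begin

section \<open>Syntax\<close>

datatype ('c, 'v) trm = Cst 'c | Var 'v

datatype ('p, 'c, 'v) atom = Atom (sym: 'p) (args: "('c, 'v) trm list")

text \<open>A predicate is a symbol together with its arity, so one symbol used with two different
  numbers of arguments stands for two different predicates.\<close>

definition pred :: "('p, 'c, 'v) atom \<Rightarrow> 'p \<times> nat" where
  "pred a = (sym a, length (args a))"

definition atom_vars :: "('p, 'c, 'v) atom \<Rightarrow> 'v set" where
  "atom_vars a = {x. Var x \<in> set (args a)}"

definition atom_consts :: "('p, 'c, 'v) atom \<Rightarrow> 'c set" where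
  "atom_consts a = {c. Cst c \<in> set (args a)}"

datatype ('p, 'c, 'v) rule =
  Rule (head: "('p, 'c, 'v) atom set")
       (pos_body: "('p, 'c, 'v) atom set")
       (neg_body: "('p, 'c, 'v) atom set")

type_synonym ('p, 'c, 'v) program = "('p, 'c, 'v) rule set"

definition atoms :: "('p, 'c, 'v) rule \<Rightarrow> ('p, 'c, 'v) atom set" where
  "atoms r = head r \<union> pos_body r \<union> neg_body r"

definition is_rule :: "('p, 'c, 'v) rule \<Rightarrow> bool" where
  "is_rule r \<longleftrightarrow> head r \<noteq> {} \<and> finite (head r) \<and> finite (pos_body r) \<and> finite (neg_body r)"

definition is_program :: "('p, 'c, 'v) program \<Rightarrow> bool" where
  "is_program P \<longleftrightarrow> finite P \<and> (\<forall>r\<in>P. is_rule r)"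

definition is_fact :: "('p, 'c, 'v) rule \<Rightarrow> bool" where
  "is_fact r \<longleftrightarrow> pos_body r = {} \<and> neg_body r = {} \<and> (\<exists>a. head r = {a} \<and> atom_vars a = {})"

text \<open>Sets of facts are finite, because they are added to programs and the result has to be
  a program again.\<close>

definition fact_set :: "('p, 'c, 'v) program \<Rightarrow> bool" where
  "fact_set F \<longleftrightarrow> finite F \<and> (\<forall>r\<in>F. is_fact r)"

text \<open>A predicate that occurs in no head is EDB.\<close>

definition edb :: "('p, 'c, 'v) program \<Rightarrow> 'p \<times> nat \<Rightarrow> bool" where
  "edb P p \<longleftrightarrow> (\<forall>r\<in>P. p \<in> pred ` head r \<longrightarrow> is_fact r)"

definition EDB :: "('p, 'c, 'v) program \<Rightarrow> ('p, 'c, 'v) program" where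
  "EDB P = {r \<in> P. \<forall>a\<in>head r. edb P (pred a)}"

definition prog_consts :: "('p, 'c, 'v) program \<Rightarrow> 'c set" where
  "prog_consts P = (\<Union>r\<in>P. \<Union>a\<in>atoms r. atom_consts a)"

definition prog_preds :: "('p, 'c, 'v) program \<Rightarrow> ('p \<times> nat) set" where
  "prog_preds P = (\<Union>r\<in>P. pred ` atoms r)"

section \<open>Semantics\<close>

definition universe :: "('p, 'c, 'v) program \<Rightarrow> 'c set" where
  "universe P = (if prog_consts P = {} then {undefined} else prog_consts P)"

definition herbrand_base :: "('p, 'c, 'v) program \<Rightarrow> ('p, 'c, 'v) atom set" where
  "herbrand_base P = {a. pred a \<in> prog_preds P \<and> set (args a) \<subseteq> Cst ` universe P}"

fun subst_trm :: "('v \<Rightarrow> 'c) \<Rightarrow> ('c, 'v) trm \<Rightarrow> ('c, 'v) trm" where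
  "subst_trm \<sigma> (Cst c) = Cst c"
| "subst_trm \<sigma> (Var x) = Cst (\<sigma> x)"

definition subst_atom :: "('v \<Rightarrow> 'c) \<Rightarrow> ('p, 'c, 'v) atom \<Rightarrow> ('p, 'c, 'v) atom" where
  "subst_atom \<sigma> a = Atom (sym a) (map (subst_trm \<sigma>) (args a))"

definition subst_rule :: "('v \<Rightarrow> 'c) \<Rightarrow> ('p, 'c, 'v) rule \<Rightarrow> ('p, 'c, 'v) rule" where
  "subst_rule \<sigma> r =
     Rule (subst_atom \<sigma> ` head r) (subst_atom \<sigma> ` pos_body r) (subst_atom \<sigma> ` neg_body r)"

definition ground :: "('p, 'c, 'v) program \<Rightarrow> ('p, 'c, 'v) program" where
  "ground P = {subst_rule \<sigma> r | \<sigma> r. r \<in> P \<and> range \<sigma> \<subseteq> universe P}"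

text \<open>Truth of a set of ground rules in an interpretation.\<close>

definition satisfies :: "('p, 'c, 'v) atom set \<Rightarrow> ('p, 'c, 'v) rule set \<Rightarrow> bool" where
  "satisfies I G \<longleftrightarrow>
     (\<forall>r\<in>G. pos_body r \<subseteq> I \<and> neg_body r \<inter> I = {} \<longrightarrow> head r \<inter> I \<noteq> {})"

definition reduct ::
  "('p, 'c, 'v) rule set \<Rightarrow> ('p, 'c, 'v) atom set \<Rightarrow> ('p, 'c, 'v) rule set" where
  "reduct G I = {Rule (head r) (pos_body r) {} | r. r \<in> G \<and> neg_body r \<inter> I = {}}"

definition answer_set :: "('p, 'c, 'v) program \<Rightarrow> ('p, 'c, 'v) atom set \<Rightarrow> bool" where
  "answer_set P M \<longleftrightarrow>
     M \<subseteq> herbrand_base P \<and> satisfies M (reduct (ground P) M) \<and>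
     (\<forall>N. N \<subset> M \<longrightarrow> \<not> satisfies N (reduct (ground P) M))"

definition super_consistent :: "('p, 'c, 'v) program \<Rightarrow> bool" where
  "super_consistent P \<longleftrightarrow> (\<forall>F. fact_set F \<longrightarrow> (\<exists>M. answer_set (P \<union> F) M))"

section \<open>Queries\<close>

definition cautious_answers ::
  "('p, 'c, 'v) atom \<Rightarrow> ('p, 'c, 'v) program \<Rightarrow> ('v \<Rightarrow> 'c) set" where
  "cautious_answers Q P =
     {\<theta> \<in> atom_vars Q \<rightarrow>\<^sub>E UNIV. \<forall>M. answer_set P M \<longrightarrow> subst_atom \<theta> Q \<in> M}"

definition brave_answers ::
  "('p, 'c, 'v) atom \<Rightarrow> ('p, 'c, 'v) program \<Rightarrow> ('v \<Rightarrow> 'c) set" where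
  "brave_answers Q P =
     {\<theta> \<in> atom_vars Q \<rightarrow>\<^sub>E UNIV. \<exists>M. answer_set P M \<and> subst_atom \<theta> Q \<in> M}"

definition common_edb_facts ::
  "('p, 'c, 'v) program \<Rightarrow> ('p, 'c, 'v) program \<Rightarrow> ('p, 'c, 'v) program \<Rightarrow> bool" where
  "common_edb_facts P P' F \<longleftrightarrow>
     fact_set F \<and> (\<forall>r\<in>F. \<forall>a\<in>head r. edb P (pred a) \<and> edb P' (pred a))"

definition cautious_equivalent ::
  "('p, 'c, 'v) atom \<Rightarrow> ('p, 'c, 'v) program \<Rightarrow> ('p, 'c, 'v) program \<Rightarrow> bool" where
  "cautious_equivalent Q P P' \<longleftrightarrow>
     (\<forall>F. common_edb_facts P P' F \<longrightarrow>
        cautious_answers Q (P \<union> F) = cautious_answers Q (P' \<union> F))"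

definition brave_equivalent ::
  "('p, 'c, 'v) atom \<Rightarrow> ('p, 'c, 'v) program \<Rightarrow> ('p, 'c, 'v) program \<Rightarrow> bool" where
  "brave_equivalent Q P P' \<longleftrightarrow>
     (\<forall>F. common_edb_facts P P' F \<longrightarrow>
        brave_answers Q (P \<union> F) = brave_answers Q (P' \<union> F))"

section \<open>Adornments and magic atoms\<close>

datatype binding = Bound | Free

type_synonym adornment = "binding list"

text \<open>The constructor \<open>Magic\<close> yields the magic symbol of a symbol and an adornment. These symbols
  are fresh for a program that uses only \<open>Base\<close> symbols. An adorned predicate is
  represented by a pair of a symbol and an adornment; its arity is the length of the adornment.\<close>

datatype 'p psym = Base 'p | Magic "'p psym" adornment

definition base_atom :: "('p psym, 'c, 'v) atom \<Rightarrow> bool" where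
  "base_atom a \<longleftrightarrow> sym a \<in> range Base"

definition base_program :: "('p psym, 'c, 'v) program \<Rightarrow> bool" where
  "base_program P \<longleftrightarrow> (\<forall>r\<in>P. \<forall>a\<in>atoms r. base_atom a)"

definition bound_args :: "adornment \<Rightarrow> 'a list \<Rightarrow> 'a list" where
  "bound_args \<alpha> ts = map snd (filter (\<lambda>(b, t). b = Bound) (zip \<alpha> ts))"

definition magic ::
  "adornment \<Rightarrow> ('p psym, 'c, 'v) atom \<Rightarrow> ('p psym, 'c, 'v) atom" where
  "magic \<alpha> a = Atom (Magic (sym a) \<alpha>) (bound_args \<alpha> (args a))"

text \<open>The adornment of the arguments of an atom when the variables in \<open>X\<close> are bound.\<close>

fun binding_of :: "'v set \<Rightarrow> ('c, 'v) trm \<Rightarrow> binding" where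
  "binding_of X (Cst c) = Bound"
| "binding_of X (Var x) = (if x \<in> X then Bound else Free)"

definition query_adornment :: "('p, 'c, 'v) atom \<Rightarrow> adornment" where
  "query_adornment Q = map (binding_of {}) (args Q)"

section \<open>Sideways information passing\<close>

type_synonym ('p, 'c, 'v) sips =
  "(('p, 'c, 'v) atom \<times> ('p, 'c, 'v) atom) set \<times> (('p, 'c, 'v) atom \<Rightarrow> 'v set)"

text \<open>The head atom \<open>a\<close> is excluded from the fifth conjunct also when it occurs in the negative
  body, since the fourth one already makes it precede all other atoms; otherwise a rule such as
  \<open>p(X) \<leftarrow> e(X), not p(X)\<close> would admit no SIPS.\<close>

definition is_sips ::
  "('p, 'c, 'v) rule \<Rightarrow> ('p, 'c, 'v) atom \<Rightarrow> adornment \<Rightarrow> ('p, 'c, 'v) sips \<Rightarrow> bool" where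
  "is_sips r a \<alpha> S \<longleftrightarrow> (case S of (prec, f) \<Rightarrow>
     prec \<subseteq> atoms r \<times> atoms r \<and> irrefl prec \<and> trans prec \<and>
     (\<forall>q \<in> atoms r - {a}. (a, q) \<in> prec) \<and>
     (\<forall>q \<in> (head r \<union> neg_body r) - {a}. \<forall>q'. (q, q') \<notin> prec) \<and>
     (\<forall>q \<in> atoms r. f q \<subseteq> atom_vars q) \<and>
     f a = {x. Var x \<in> set (bound_args \<alpha> (args a))})"

type_synonym ('p, 'c, 'v) sips_choice =
  "('p, 'c, 'v) rule \<Rightarrow> ('p, 'c, 'v) atom \<Rightarrow> adornment \<Rightarrow> ('p, 'c, 'v) sips"

definition valid_sips_choice ::
  "('p, 'c, 'v) program \<Rightarrow> ('p, 'c, 'v) sips_choice \<Rightarrow> bool" where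
  "valid_sips_choice P S \<longleftrightarrow>
     (\<forall>r\<in>P. \<forall>a\<in>head r. \<forall>\<alpha>. length \<alpha> = length (args a) \<longrightarrow> is_sips r a \<alpha> (S r a \<alpha>))"

section \<open>The rewriting\<close>

text \<open>The adorned rule is represented by the labelling of the atoms of \<open>r\<close> that gives each
  atom its adornment, or \<open>None\<close> if the atom is not adorned.\<close>

definition adorned_rule ::
  "('p, 'c, 'v) program \<Rightarrow> ('p, 'c, 'v) sips_choice \<Rightarrow> ('p, 'c, 'v) rule \<Rightarrow>
     ('p, 'c, 'v) atom \<Rightarrow> adornment \<Rightarrow> ('p, 'c, 'v) atom \<Rightarrow> adornment option" where
  "adorned_rule P S r a \<alpha> q = (case S r a \<alpha> of (prec, f) \<Rightarrow>
     if q = a then Some \<alpha>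
     else if edb P (pred q) then None
     else Some (map (binding_of (f a \<union> (\<Union>b \<in> {b \<in> pos_body r. (b, q) \<in> prec}. f b))) (args q)))"

definition magic_rules ::
  "('p psym, 'c, 'v) program \<Rightarrow> ('p psym, 'c, 'v) sips_choice \<Rightarrow> ('p psym, 'c, 'v) rule \<Rightarrow>
     ('p psym, 'c, 'v) atom \<Rightarrow> adornment \<Rightarrow> ('p psym, 'c, 'v) program" where
  "magic_rules P S r a \<alpha> =
     {Rule {magic \<beta> q} ({magic \<alpha> a} \<union> {b \<in> atoms r - {a}. (b, q) \<in> fst (S r a \<alpha>)}) {} | q \<beta>.
        q \<in> atoms r - {a} \<and> adorned_rule P S r a \<alpha> q = Some \<beta>}"

definition modified_rule ::
  "('p psym, 'c, 'v) program \<Rightarrow> ('p psym, 'c, 'v) sips_choice \<Rightarrow> ('p psym, 'c, 'v) rule \<Rightarrow>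
     ('p psym, 'c, 'v) atom \<Rightarrow> adornment \<Rightarrow> ('p psym, 'c, 'v) rule" where
  "modified_rule P S r a \<alpha> =
     Rule (head r)
       (pos_body r \<union> {magic \<gamma> h | h \<gamma>. h \<in> head r \<and> adorned_rule P S r a \<alpha> h = Some \<gamma>})
       (neg_body r)"

text \<open>The adorned predicates ever inserted into the worklist of the algorithm.\<close>

inductive_set adorned_preds ::
  "('p, 'c, 'v) atom \<Rightarrow> ('p, 'c, 'v) program \<Rightarrow> ('p, 'c, 'v) sips_choice \<Rightarrow> ('p \<times> adornment) set"
  for Q P S where
  seed: "(sym Q, query_adornment Q) \<in> adorned_preds Q P S"
| step: "(p, \<alpha>) \<in> adorned_preds Q P S \<Longrightarrow> r \<in> P \<Longrightarrow> a \<in> head r \<Longrightarrow> pred a = (p, length \<alpha>) \<Longrightarrow>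
     q \<in> atoms r \<Longrightarrow> adorned_rule P S r a \<alpha> q = Some \<beta> \<Longrightarrow> (sym q, \<beta>) \<in> adorned_preds Q P S"

definition DMS ::
  "('p psym, 'c, 'v) sips_choice \<Rightarrow> ('p psym, 'c, 'v) atom \<Rightarrow> ('p psym, 'c, 'v) program \<Rightarrow>
     ('p psym, 'c, 'v) program" where
  "DMS S Q P =
     {Rule {magic (query_adornment Q) Q} {} {}} \<union>
     \<Union> {insert (modified_rule P S r a \<alpha>) (magic_rules P S r a \<alpha>) | r a p \<alpha>.
          (p, \<alpha>) \<in> adorned_preds Q P S \<and> r \<in> P \<and> a \<in> head r \<and> pred a = (p, length \<alpha>)} \<union>
     EDB P"

section \<open>Safety\<close>

text \<open>Every variable of the rule occurs in its positive body. Answer sets of a safe program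
  consist of atoms over the constants of the program, so they do not change if further constants
  are added to the universe. Without safety, \<open>DMS\<close> can change the answers of a query by losing
  constants. For \<open>P = {g(X) \<leftarrow>. h(c) \<leftarrow> e(d).}\<close> and the query \<open>g(X)?\<close>, the
  answers are \<open>c\<close> and \<open>d\<close>, but \<open>DMS S Q P = {magic_g. g(X) \<leftarrow> magic_g.}\<close> has a one-element
  universe.\<close>

definition safe_program :: "('p, 'c, 'v) program \<Rightarrow> bool" where
  "safe_program P \<longleftrightarrow> (\<forall>r\<in>P. \<forall>a\<in>atoms r. atom_vars a \<subseteq> (\<Union>b\<in>pos_body r. atom_vars b))"

end

theory Submission
  imports Defs
begin

text \<open>Fix the facts \<open>F\<close> and ground over one universe; safety or the hypothesis on the constants makes
  this harmless. An atom is relevant in \<open>X\<close> if its predicate is EDB or one of its magic versions is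
  in \<open>X\<close>. By induction along the SIPS, if one head atom of a ground rule is relevant and the
  relevant part of the positive body holds, then all atoms of the rule are relevant and the
  modified rule fires.

  For an answer set \<open>M'\<close> of the rewritten program, super-consistency yields an answer set \<open>M\<close> of
  the original program extended by the non-magic atoms of \<open>M'\<close> as facts. It agrees with \<open>M'\<close> on
  relevant atoms, and the minimality of \<open>M'\<close> shows that the added facts can be dropped again.
  Conversely, from an answer set \<open>M\<close> of the original program, compute the magic atoms by reading the
  bodies of the magic rules in \<open>M\<close>, and keep the relevant part of \<open>M\<close>. If \<open>N\<close> is a smaller model of
  the reduct, then replacing in \<open>M\<close> the atoms relevant in \<open>N\<close> by those of \<open>N\<close> yields a model of the
  reduct of the original program, so nothing was lost. All instances of the query are relevant because
  of the magic seed.\<close>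

section \<open>Stable models over a given universe\<close>

text \<open>Two interpretations separate the roles in the reduct: \<open>M\<close> decides which
  rules survive, \<open>N\<close> is tested on the survivors. The universe is a parameter so that
  both programs can be grounded over the same constants.\<close>

definition models ::
  "'c set \<Rightarrow> ('p, 'c, 'v) program \<Rightarrow> ('p, 'c, 'v) atom set \<Rightarrow> ('p, 'c, 'v) atom set \<Rightarrow> bool" where
  "models U P M N \<longleftrightarrow>
     (\<forall>r\<in>P. \<forall>\<sigma>. range \<sigma> \<subseteq> U \<longrightarrow> subst_atom \<sigma> ` pos_body r \<subseteq> N \<longrightarrow>
        subst_atom \<sigma> ` neg_body r \<inter> M = {} \<longrightarrow> subst_atom \<sigma> ` head r \<inter> N \<noteq> {})"

definition stable :: "'c set \<Rightarrow> ('p, 'c, 'v) program \<Rightarrow> ('p, 'c, 'v) atom set \<Rightarrow> bool" where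
  "stable U P M \<longleftrightarrow> models U P M M \<and> (\<forall>N. N \<subset> M \<longrightarrow> \<not> models U P M N)"

lemma modelsI:
  assumes "\<And>r \<sigma>. r \<in> P \<Longrightarrow> range \<sigma> \<subseteq> U \<Longrightarrow> subst_atom \<sigma> ` pos_body r \<subseteq> N \<Longrightarrow>
    subst_atom \<sigma> ` neg_body r \<inter> M = {} \<Longrightarrow> \<exists>h\<in>head r. subst_atom \<sigma> h \<in> N"
  shows "models U P M N"
  unfolding models_def
proof (intro ballI allI impI)
  fix r \<sigma>
  assume "r \<in> P" "range \<sigma> \<subseteq> U" "subst_atom \<sigma> ` pos_body r \<subseteq> N"
    "subst_atom \<sigma> ` neg_body r \<inter> M = {}"
  from assms[OF this] show "subst_atom \<sigma> ` head r \<inter> N \<noteq> {}" by blast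
qed

lemma modelsD:
  assumes "models U P M N" "r \<in> P" "range \<sigma> \<subseteq> U" "subst_atom \<sigma> ` pos_body r \<subseteq> N"
    "subst_atom \<sigma> ` neg_body r \<inter> M = {}"
  obtains h where "h \<in> head r" "subst_atom \<sigma> h \<in> N"
proof -
  have "subst_atom \<sigma> ` head r \<inter> N \<noteq> {}" using assms(1-5) unfolding models_def by simp
  then show thesis using that by blast
qed

lemma models_Un: "models U (P \<union> P') M N \<longleftrightarrow> models U P M N \<and> models U P' M N"
  unfolding models_def by (simp add: ball_Un)

lemma stable_minimal: "stable U P M \<Longrightarrow> N \<subseteq> M \<Longrightarrow> models U P M N \<Longrightarrow> N = M"
  unfolding stable_def by blast

lemma satisfies_reduct_ground:
  "satisfies N (reduct (ground P) M) \<longleftrightarrow> models (universe P) P M N"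
proof -
  have "satisfies N (reduct (ground P) M) \<longleftrightarrow> (\<forall>r\<in>ground P.
      pos_body r \<subseteq> N \<longrightarrow> neg_body r \<inter> M = {} \<longrightarrow> head r \<inter> N \<noteq> {})"
    unfolding satisfies_def reduct_def by fastforce
  also have "\<dots> \<longleftrightarrow> models (universe P) P M N"
    unfolding ground_def models_def subst_rule_def by fastforce
  finally show ?thesis .
qed

lemma universe_nonempty: "universe P \<noteq> {}"
  unfolding universe_def by simp

lemma prog_consts_subset_universe: "prog_consts P \<subseteq> universe P"
  unfolding universe_def by simp

lemma prog_consts_Un: "prog_consts (P \<union> P') = prog_consts P \<union> prog_consts P'"
  unfolding prog_consts_def by auto

section \<open>Ground instances of atoms and supportedness\<close>

lemma sym_subst [simp]: "sym (subst_atom \<sigma> a) = sym a"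
  and args_subst: "args (subst_atom \<sigma> a) = map (subst_trm \<sigma>) (args a)"
  and length_args_subst [simp]: "length (args (subst_atom \<sigma> a)) = length (args a)"
  unfolding subst_atom_def by auto

lemma pred_subst [simp]: "pred (subst_atom \<sigma> a) = pred a"
  unfolding pred_def by simp

lemma base_atom_subst [simp]: "base_atom (subst_atom \<sigma> a) \<longleftrightarrow> base_atom a"
  unfolding base_atom_def by simp

lemma subst_atom_cong:
  assumes "\<And>x. x \<in> atom_vars a \<Longrightarrow> \<sigma> x = \<tau> x"
  shows "subst_atom \<sigma> a = subst_atom \<tau> a"
proof -
  have "subst_trm \<sigma> t = subst_trm \<tau> t" if "t \<in> set (args a)" for t
    by (cases t) (use that assms in \<open>auto simp: atom_vars_def\<close>)
  then show ?thesis unfolding subst_atom_def by auto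
qed

lemma subst_atom_ground:
  assumes "atom_vars a = {}" shows "subst_atom \<sigma> a = a"
proof -
  have "subst_trm \<sigma> t = t" if "t \<in> set (args a)" for t
    by (cases t) (use that assms in \<open>auto simp: atom_vars_def\<close>)
  then have "map (subst_trm \<sigma>) (args a) = args a" by (simp add: map_idI)
  then show ?thesis unfolding subst_atom_def by simp
qed

lemma args_subst_subset_iff:
  "set (args (subst_atom \<sigma> a)) \<subseteq> Cst ` C \<longleftrightarrow> atom_consts a \<subseteq> C \<and> \<sigma> ` atom_vars a \<subseteq> C"
proof -
  have "subst_trm \<sigma> t \<in> Cst ` C \<longleftrightarrow> (\<forall>c. t = Cst c \<longrightarrow> c \<in> C) \<and> (\<forall>x. t = Var x \<longrightarrow> \<sigma> x \<in> C)" for t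
    by (cases t) auto
  then show ?thesis unfolding args_subst atom_consts_def atom_vars_def
    by (auto simp: subset_iff)
qed

lemma atom_vars_empty_if_args: "set (args a) \<subseteq> Cst ` C \<Longrightarrow> atom_vars a = {}"
  unfolding atom_vars_def by auto

text \<open>Removing from \<open>M\<close> all atoms that are no head instance violates no rule, so
  minimality leaves no such atom.\<close>

lemma stable_supported:
  assumes "stable U P M" "a \<in> M"
  obtains r \<sigma> h where "r \<in> P" "range \<sigma> \<subseteq> U" "h \<in> head r" "a = subst_atom \<sigma> h"
proof -
  let ?H = "{subst_atom \<sigma> h | \<sigma> r h. r \<in> P \<and> range \<sigma> \<subseteq> U \<and> h \<in> head r}"
  have "models U P M M" using assms unfolding stable_def by simp
  have "models U P M (M \<inter> ?H)"
  proof (rule modelsI)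
    fix r \<sigma>
    assume r: "r \<in> P" "range \<sigma> \<subseteq> U" "subst_atom \<sigma> ` pos_body r \<subseteq> M \<inter> ?H"
      "subst_atom \<sigma> ` neg_body r \<inter> M = {}"
    have "subst_atom \<sigma> ` pos_body r \<subseteq> M" using r(3) by blast
    then obtain h where "h \<in> head r" "subst_atom \<sigma> h \<in> M"
      using modelsD[OF \<open>models U P M M\<close> r(1,2) _ r(4)] by blast
    then show "\<exists>h\<in>head r. subst_atom \<sigma> h \<in> M \<inter> ?H" using r(1,2) by blast
  qed
  then have "M \<inter> ?H = M" by (rule stable_minimal[OF assms(1) Int_lower1])
  then show thesis using that assms(2) by blast
qed

lemma subst_in_herbrand_base:
  assumes "r \<in> P" "a \<in> atoms r" "range \<sigma> \<subseteq> universe P"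
  shows "subst_atom \<sigma> a \<in> herbrand_base P"
proof -
  have "atom_consts a \<subseteq> universe P" "pred a \<in> prog_preds P"
    using assms prog_consts_subset_universe[of P] unfolding prog_consts_def prog_preds_def by auto
  moreover have "\<sigma> ` atom_vars a \<subseteq> universe P" using assms(3) by blast
  ultimately show ?thesis unfolding herbrand_base_def by (simp add: args_subst_subset_iff)
qed

text \<open>Supported atoms instantiate head atoms, and over the program's own universe such
  instances lie in the Herbrand base.\<close>

lemma stable_universe_subset_herbrand_base:
  assumes "stable (universe P) P M" shows "M \<subseteq> herbrand_base P"
proof
  fix a assume "a \<in> M"
  then obtain r \<sigma> h where "r \<in> P" "range \<sigma> \<subseteq> universe P" "h \<in> head r" "a = subst_atom \<sigma> h"
    using stable_supported[OF assms] by metis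
  then show "a \<in> herbrand_base P" using subst_in_herbrand_base[of r P h \<sigma>] unfolding atoms_def by auto
qed

lemma answer_set_iff_stable: "answer_set P M \<longleftrightarrow> stable (universe P) P M"
proof -
  have "answer_set P M \<longleftrightarrow> M \<subseteq> herbrand_base P \<and> stable (universe P) P M"
    unfolding answer_set_def satisfies_reduct_ground stable_def by (rule refl)
  then show ?thesis using stable_universe_subset_herbrand_base[of P M] by argo
qed

section \<open>Safe programs and change of universe\<close>

lemma safe_subst_into_consts:
  assumes "safe_program P" "r \<in> P"
    and "subst_atom \<sigma> ` pos_body r \<subseteq> {a. set (args a) \<subseteq> Cst ` C}"
    and "a \<in> atoms r"
  shows "\<sigma> ` atom_vars a \<subseteq> C"
proof -
  have "\<sigma> ` atom_vars b \<subseteq> C" if "b \<in> pos_body r" for b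
    using assms(3) that by (auto simp: image_subset_iff args_subst_subset_iff)
  moreover have "atom_vars a \<subseteq> (\<Union>b\<in>pos_body r. atom_vars b)"
    using assms(1,2,4) unfolding safe_program_def by simp
  ultimately show ?thesis by (auto simp: image_subset_iff subset_iff)
qed

text \<open>In a safe rule the positive body determines the values of all variables. Bodies over the
  constants of \<open>P\<close> thus yield heads over them, and minimality excludes all other
  atoms.\<close>

lemma stable_safe_consts:
  assumes "safe_program P" "stable U P M"
  shows "M \<subseteq> {a. set (args a) \<subseteq> Cst ` prog_consts P}" (is "M \<subseteq> ?B")
proof -
  have "models U P M (M \<inter> ?B)"
  proof (rule modelsI)
    fix r \<sigma>
    assume r: "r \<in> P" "range \<sigma> \<subseteq> U" "subst_atom \<sigma> ` pos_body r \<subseteq> M \<inter> ?B"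
      "subst_atom \<sigma> ` neg_body r \<inter> M = {}"
    have "models U P M M" using assms unfolding stable_def by simp
    moreover have "subst_atom \<sigma> ` pos_body r \<subseteq> M" using r by blast
    ultimately obtain h where h: "h \<in> head r" "subst_atom \<sigma> h \<in> M"
      using r by (elim modelsD) auto
    have "h \<in> atoms r" using h unfolding atoms_def by simp
    moreover have "subst_atom \<sigma> ` pos_body r \<subseteq> ?B" using r by blast
    ultimately have "\<sigma> ` atom_vars h \<subseteq> prog_consts P"
      by (rule safe_subst_into_consts[OF assms(1) r(1), rotated])
    moreover have "atom_consts h \<subseteq> prog_consts P"
      using \<open>h \<in> atoms r\<close> r(1) unfolding prog_consts_def by blast
    ultimately have "subst_atom \<sigma> h \<in> ?B" by (simp add: args_subst_subset_iff)
    then show "\<exists>h\<in>head r. subst_atom \<sigma> h \<in> M \<inter> ?B" using h by blast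
  qed
  then have "M \<inter> ?B = M" by (rule stable_minimal[OF assms(2) Int_lower1])
  then show ?thesis by blast
qed

lemma models_safe_universe:
  assumes "safe_program P" "models U P M N"
    and "N \<subseteq> {a. set (args a) \<subseteq> Cst ` C}" "C \<subseteq> U" "U \<noteq> {}"
  shows "models V P M N"
proof (rule modelsI)
  fix r \<sigma>
  assume r: "r \<in> P" "range \<sigma> \<subseteq> V" "subst_atom \<sigma> ` pos_body r \<subseteq> N"
    "subst_atom \<sigma> ` neg_body r \<inter> M = {}"
  obtain u where "u \<in> U" using assms(5) by blast
  \<comment> \<open>Values outside \<open>C\<close> are redirected to some element of
    \<open>U\<close>. If the body instance holds in \<open>N\<close>, safety puts all variables of
    the rule into \<open>C\<close>, so the instance itself is unchanged.\<close>
  define \<tau> where "\<tau> x = (if \<sigma> x \<in> C then \<sigma> x else u)" for x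
  have eq: "subst_atom \<tau> a = subst_atom \<sigma> a" if "a \<in> atoms r" for a
  proof (rule subst_atom_cong)
    have "\<sigma> ` atom_vars a \<subseteq> C"
      using safe_subst_into_consts[OF assms(1) r(1) _ that] r(3) assms(3) by blast
    then show "\<tau> x = \<sigma> x" if "x \<in> atom_vars a" for x
      using that unfolding \<tau>_def by auto
  qed
  have "range \<tau> \<subseteq> U" using \<open>u \<in> U\<close> assms(4) unfolding \<tau>_def by auto
  moreover have "subst_atom \<tau> ` pos_body r \<subseteq> N" "subst_atom \<tau> ` neg_body r \<inter> M = {}"
    using r(3,4) eq unfolding atoms_def by (auto simp: image_subset_iff)
  ultimately obtain h where "h \<in> head r" "subst_atom \<tau> h \<in> N"
    using assms(2) r(1) by (elim modelsD)
  then show "\<exists>h\<in>head r. subst_atom \<sigma> h \<in> N" using eq unfolding atoms_def by auto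
qed

text \<open>Since \<open>M\<close> mentions only constants of \<open>P\<close>, so does every
  competitor \<open>N\<close> in the minimality condition, and \<open>models_safe_universe\<close>
  transfers the model property in both directions.\<close>

lemma stable_safe_universe:
  assumes "safe_program P" "stable U P M"
    and "prog_consts P \<subseteq> U" "U \<noteq> {}" "prog_consts P \<subseteq> V" "V \<noteq> {}"
  shows "stable V P M"
proof -
  note M = stable_safe_consts[OF assms(1,2)]
  have "models U P M N \<longleftrightarrow> models V P M N" if "N \<subseteq> M" for N
    using models_safe_universe[OF assms(1) _ order.trans[OF that M]] assms(3-6) by blast
  then show ?thesis using assms(2) unfolding stable_def by blast
qed

section \<open>Facts and finiteness of the Herbrand base\<close>

lemma is_fact_cases:
  assumes "is_fact r"
  obtains a where "r = Rule {a} {} {}" "atom_vars a = {}"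
  using assms unfolding is_fact_def by (cases r) auto

lemma models_facts_iff:
  fixes F :: "('p, 'c, 'v) program"
  assumes "\<forall>r\<in>F. is_fact r" "U \<noteq> {}"
  shows "models U F M N \<longleftrightarrow> (\<forall>r\<in>F. head r \<subseteq> N)"
proof -
  obtain u where "u \<in> U" using assms(2) by blast
  \<comment> \<open>A nonempty universe guarantees at least one grounding substitution, so each fact
    has an instance.\<close>
  then have ex: "\<exists>\<sigma>::'v \<Rightarrow> 'c. range \<sigma> \<subseteq> U" by (intro exI[of _ "\<lambda>_. u"]) auto
  have "(\<forall>\<sigma>. range \<sigma> \<subseteq> U \<longrightarrow> subst_atom \<sigma> ` pos_body r \<subseteq> N \<longrightarrow>
        subst_atom \<sigma> ` neg_body r \<inter> M = {} \<longrightarrow> subst_atom \<sigma> ` head r \<inter> N \<noteq> {}) \<longleftrightarrow> head r \<subseteq> N"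
    if "r \<in> F" for r
  proof -
    have "is_fact r" using that assms(1) by simp
    then obtain a where "r = Rule {a} {} {}" "atom_vars a = {}" by (rule is_fact_cases)
    then show ?thesis using ex by (auto simp: subst_atom_ground)
  qed
  then show ?thesis unfolding models_def by simp
qed

text \<open>Super-consistency speaks of finite sets of facts; this bound allows the base atoms of an
  answer set to be added as such a set.\<close>

lemma finite_herbrand_base:
  assumes "is_program P" shows "finite (herbrand_base P)"
proof -
  have fin: "finite P" "\<And>r. r \<in> P \<Longrightarrow> finite (atoms r)"
    using assms unfolding is_program_def is_rule_def atoms_def by auto
  have "finite (atom_consts a)" for a :: "('a, 'b, 'c) atom"
  proof (rule finite_subset)
    show "atom_consts a \<subseteq> (\<lambda>t. case t of Cst c \<Rightarrow> c) ` set (args a)"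
      unfolding atom_consts_def by force
  qed simp
  then have "finite (universe P)" using fin unfolding universe_def prog_consts_def by auto
  then have "finite {ts. set ts \<subseteq> Cst ` universe P \<and> length ts = n}" for n
    by (intro finite_lists_length_eq) auto
  moreover have "finite (prog_preds P)" using fin unfolding prog_preds_def by auto
  moreover have "herbrand_base P \<subseteq> (\<Union>(p, n)\<in>prog_preds P.
      Atom p ` {ts. set ts \<subseteq> Cst ` universe P \<and> length ts = n})"
  proof
    fix a assume "a \<in> herbrand_base P"
    then show "a \<in> (\<Union>(p, n)\<in>prog_preds P.
      Atom p ` {ts. set ts \<subseteq> Cst ` universe P \<and> length ts = n})"
      by (cases a) (auto simp: herbrand_base_def pred_def intro!: bexI[rotated] imageI)
  qed
  ultimately show ?thesis by (elim finite_subset) auto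
qed

section \<open>Magic atoms and sideways information passing\<close>

lemma bound_args_map: "bound_args \<alpha> (map f ts) = map f (bound_args \<alpha> ts)"
  unfolding bound_args_def by (simp add: zip_map2 filter_map o_def case_prod_unfold)

lemma set_bound_args: "set (bound_args \<alpha> ts) \<subseteq> set ts"
  unfolding bound_args_def by (auto dest: set_zip_rightD)

lemma bound_args_binding:
  "Var x \<in> set (bound_args (map (binding_of X) ts) ts) \<Longrightarrow> x \<in> X"
  unfolding bound_args_def by (induction ts) (auto split: if_splits)

lemma subst_magic: "subst_atom \<sigma> (magic \<alpha> a) = magic \<alpha> (subst_atom \<sigma> a)"
  unfolding magic_def subst_atom_def by (simp add: bound_args_map)

lemma not_base_magic [simp]: "\<not> base_atom (magic \<alpha> a)"
  unfolding base_atom_def magic_def by auto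

lemma atom_vars_magic: "atom_vars (magic \<alpha> a) \<subseteq> atom_vars a"
  and atom_consts_magic: "atom_consts (magic \<alpha> a) \<subseteq> atom_consts a"
  using set_bound_args[of \<alpha> "args a"] unfolding atom_vars_def atom_consts_def magic_def by auto

text \<open>With no variable bound in advance, only the constants of the query survive in the seed,
  which is therefore a fact.\<close>

lemma atom_vars_seed: "atom_vars (magic (query_adornment Q) Q) = {}"
  using bound_args_binding[of _ "{}"] unfolding atom_vars_def magic_def query_adornment_def by auto


lemma models_UN: "models U (\<Union>x\<in>A. G x) M N \<longleftrightarrow> (\<forall>x\<in>A. models U (G x) M N)"
  unfolding models_def by simp

lemma models_mono: "models U P M N \<Longrightarrow> P' \<subseteq> P \<Longrightarrow> models U P' M N"
  unfolding models_def by (simp add: subset_iff)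

text \<open>The facts in \<open>F\<close> are over EDB predicates of \<open>P\<close>. These include
  magic predicates, which occur in no head of \<open>P\<close>, so \<open>F\<close> may contain
  magic atoms.\<close>

locale magic_sets =
  fixes P :: "('p psym, 'c, 'v) program" and Q :: "('p psym, 'c, 'v) atom"
    and S :: "('p psym, 'c, 'v) sips_choice"
    and F :: "('p psym, 'c, 'v) program" and U :: "'c set"
  assumes program: "is_program P" and base_program: "base_program P"
    and base_query: "base_atom Q" and sips: "valid_sips_choice P S"
    and fact_set: "fact_set F" and edb_facts: "\<lbrakk>r \<in> F; a \<in> head r\<rbrakk> \<Longrightarrow> edb P (pred a)"
    and U_nonempty: "U \<noteq> {}"
begin

definition active where
  "active r a \<alpha> \<longleftrightarrow>
     r \<in> P \<and> a \<in> head r \<and> (sym a, \<alpha>) \<in> adorned_preds Q P S \<and> length \<alpha> = length (args a)"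

text \<open>A magic version under any reached adornment counts, so different calls of a predicate
  are merged. The length condition fixes the arity, since \<open>adorned_preds\<close> records only
  a symbol and an adornment.\<close>

definition relevant :: "('p psym, 'c, 'v) atom set \<Rightarrow> ('p psym, 'c, 'v) atom set" where
  "relevant X = {q. base_atom q \<and> (edb P (pred q) \<or>
     (\<exists>\<beta>. (sym q, \<beta>) \<in> adorned_preds Q P S \<and> length \<beta> = length (args q) \<and> magic \<beta> q \<in> X))}"

text \<open>The reading of all magic rules in \<open>X\<close>. They have no negative body, so no
  second interpretation enters.\<close>

definition magic_closed where
  "magic_closed X \<longleftrightarrow> (\<forall>r a \<alpha> q \<beta> \<sigma>. active r a \<alpha> \<longrightarrow> q \<in> atoms r - {a} \<longrightarrow>
     adorned_rule P S r a \<alpha> q = Some \<beta> \<longrightarrow> range \<sigma> \<subseteq> U \<longrightarrow> magic \<alpha> (subst_atom \<sigma> a) \<in> X \<longrightarrow>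
     (\<forall>b \<in> atoms r - {a}. (b, q) \<in> fst (S r a \<alpha>) \<longrightarrow> subst_atom \<sigma> b \<in> X) \<longrightarrow>
     magic \<beta> (subst_atom \<sigma> q) \<in> X)"

definition models_modified where
  "models_modified M N \<longleftrightarrow> (\<forall>r a \<alpha> \<sigma>. active r a \<alpha> \<longrightarrow> range \<sigma> \<subseteq> U \<longrightarrow>
     (\<forall>b\<in>pos_body r. subst_atom \<sigma> b \<in> N) \<longrightarrow>
     (\<forall>h\<in>head r. \<forall>\<gamma>. adorned_rule P S r a \<alpha> h = Some \<gamma> \<longrightarrow> magic \<gamma> (subst_atom \<sigma> h) \<in> N) \<longrightarrow>
     (\<forall>b\<in>neg_body r. subst_atom \<sigma> b \<notin> M) \<longrightarrow> (\<exists>h\<in>head r. subst_atom \<sigma> h \<in> N))"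

section \<open>Models of the rewritten program\<close>

lemma base_atoms: "r \<in> P \<Longrightarrow> a \<in> atoms r \<Longrightarrow> base_atom a"
  using base_program unfolding base_program_def by blast

lemma edb_head:
  assumes "r \<in> P" "a \<in> head r" "edb P (pred a)"
  shows "r = Rule {a} {} {}" "atom_vars a = {}" "r \<in> EDB P"
proof -
  have "is_fact r" using assms unfolding edb_def by blast
  then show *: "r = Rule {a} {} {}" "atom_vars a = {}"
    using assms(2) by (auto elim!: is_fact_cases)
  show "r \<in> EDB P" using assms *(1) unfolding EDB_def by auto
qed

lemma EDB_facts:
  assumes "r \<in> EDB P" shows "is_fact r" "a \<in> head r \<Longrightarrow> edb P (pred a)"
proof -
  have "r \<in> P" "\<forall>a\<in>head r. edb P (pred a)" using assms unfolding EDB_def by auto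
  moreover have "head r \<noteq> {}"
    using \<open>r \<in> P\<close> program unfolding is_program_def is_rule_def by blast
  ultimately show "is_fact r" "a \<in> head r \<Longrightarrow> edb P (pred a)" unfolding edb_def by auto
qed

lemma DMS_eq:
  "DMS S Q P = (\<Union>(r, a, \<alpha>)\<in>{(r, a, \<alpha>). active r a \<alpha>}.
       insert (modified_rule P S r a \<alpha>) (magic_rules P S r a \<alpha>)) \<union>
     insert (Rule {magic (query_adornment Q) Q} {} {}) (EDB P)"
proof -
  have "{insert (modified_rule P S r a \<alpha>) (magic_rules P S r a \<alpha>) | r a p \<alpha>.
      (p, \<alpha>) \<in> adorned_preds Q P S \<and> r \<in> P \<and> a \<in> head r \<and> pred a = (p, length \<alpha>)} =
    (\<lambda>(r, a, \<alpha>). insert (modified_rule P S r a \<alpha>) (magic_rules P S r a \<alpha>)) ` {(r, a, \<alpha>). active r a \<alpha>}"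
    unfolding active_def pred_def by (rule set_eqI, simp add: image_iff Bex_def) metis
  then show ?thesis unfolding DMS_def by auto
qed

lemma models_modified_rule:
  "models U {modified_rule P S r a \<alpha>} M N \<longleftrightarrow> (\<forall>\<sigma>. range \<sigma> \<subseteq> U \<longrightarrow>
     (\<forall>b\<in>pos_body r. subst_atom \<sigma> b \<in> N) \<longrightarrow>
     (\<forall>h\<in>head r. \<forall>\<gamma>. adorned_rule P S r a \<alpha> h = Some \<gamma> \<longrightarrow> magic \<gamma> (subst_atom \<sigma> h) \<in> N) \<longrightarrow>
     (\<forall>b\<in>neg_body r. subst_atom \<sigma> b \<notin> M) \<longrightarrow> (\<exists>h\<in>head r. subst_atom \<sigma> h \<in> N))"
proof -
  have "subst_atom \<sigma> ` (pos_body r \<union> {magic \<gamma> h | h \<gamma>. h \<in> head r \<and> adorned_rule P S r a \<alpha> h = Some \<gamma>})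
      \<subseteq> N \<longleftrightarrow> (\<forall>b\<in>pos_body r. subst_atom \<sigma> b \<in> N) \<and>
     (\<forall>h\<in>head r. \<forall>\<gamma>. adorned_rule P S r a \<alpha> h = Some \<gamma> \<longrightarrow> magic \<gamma> (subst_atom \<sigma> h) \<in> N)" for \<sigma>
    by (auto simp: image_subset_iff subst_magic[symmetric])
  moreover have "subst_atom \<sigma> ` X \<inter> Y = {} \<longleftrightarrow> (\<forall>b\<in>X. subst_atom \<sigma> b \<notin> Y)"
    for \<sigma> and X Y :: "('p psym, 'c, 'v) atom set"
    by auto
  ultimately show ?thesis unfolding models_def modified_rule_def by (simp add: imp_conjL)
qed

lemma models_magic_rules:
  "models U (magic_rules P S r a \<alpha>) M N \<longleftrightarrow> (\<forall>q \<beta> \<sigma>. q \<in> atoms r - {a} \<longrightarrow>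
     adorned_rule P S r a \<alpha> q = Some \<beta> \<longrightarrow> range \<sigma> \<subseteq> U \<longrightarrow> magic \<alpha> (subst_atom \<sigma> a) \<in> N \<longrightarrow>
     (\<forall>b \<in> atoms r - {a}. (b, q) \<in> fst (S r a \<alpha>) \<longrightarrow> subst_atom \<sigma> b \<in> N) \<longrightarrow>
     magic \<beta> (subst_atom \<sigma> q) \<in> N)"
proof -
  have body: "subst_atom \<sigma> ` ({magic \<alpha> a} \<union> {b \<in> atoms r. b \<noteq> a \<and> (b, q) \<in> fst (S r a \<alpha>)}) \<subseteq> N \<longleftrightarrow>
      magic \<alpha> (subst_atom \<sigma> a) \<in> N \<and>
      (\<forall>b \<in> atoms r - {a}. (b, q) \<in> fst (S r a \<alpha>) \<longrightarrow> subst_atom \<sigma> b \<in> N)" for \<sigma> q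
    by (auto simp: image_subset_iff subst_magic)
  have eq: "magic_rules P S r a \<alpha> =
      (\<Union>(q, \<beta>)\<in>{(q, \<beta>). q \<in> atoms r - {a} \<and> adorned_rule P S r a \<alpha> q = Some \<beta>}.
        {Rule {magic \<beta> q} ({magic \<alpha> a} \<union> {b \<in> atoms r - {a}. (b, q) \<in> fst (S r a \<alpha>)}) {}})"
    unfolding magic_rules_def by auto
  show ?thesis
    unfolding eq models_UN models_def
    by (simp add: body subst_magic imp_conjL del: Un_insert_left insert_is_Un)
qed

text \<open>The working form of the reduct of the rewriting: seed, magic rules, modified rules and
  facts become separate conditions, and only the modified ones depend on \<open>M\<close>.\<close>

lemma models_DMS:
  "models U (DMS S Q P \<union> F) M N \<longleftrightarrow>
     magic (query_adornment Q) Q \<in> N \<and> magic_closed N \<and> models_modified M N \<and>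
     (\<forall>r \<in> EDB P \<union> F. head r \<subseteq> N)"
proof -
  let ?seed = "Rule {magic (query_adornment Q) Q} {} {}"
  have "is_fact ?seed" unfolding is_fact_def by (simp add: atom_vars_seed)
  then have "\<forall>r \<in> insert ?seed (EDB P) \<union> F. is_fact r"
    using EDB_facts(1) fact_set unfolding fact_set_def by auto
  note facts = models_facts_iff[OF this U_nonempty]
  have ins: "models U (insert (modified_rule P S r a \<alpha>) (magic_rules P S r a \<alpha>)) M N \<longleftrightarrow>
      models U {modified_rule P S r a \<alpha>} M N \<and> models U (magic_rules P S r a \<alpha>) M N" for r a \<alpha>
    using models_Un[of U "{modified_rule P S r a \<alpha>}" "magic_rules P S r a \<alpha>" M N] by simp
  have "models U (DMS S Q P \<union> F) M N \<longleftrightarrow>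
     (\<forall>r a \<alpha>. active r a \<alpha> \<longrightarrow>
       models U {modified_rule P S r a \<alpha>} M N \<and> models U (magic_rules P S r a \<alpha>) M N) \<and>
     models U (insert ?seed (EDB P) \<union> F) M N"
    unfolding DMS_eq Un_assoc
    by (subst models_Un, subst models_UN) (simp add: ins)
  then show ?thesis
    unfolding facts models_modified_rule models_magic_rules magic_closed_def models_modified_def
    by auto
qed

section \<open>Propagation of magic atoms along the SIPS\<close>

lemma active_sips: "active r a \<alpha> \<Longrightarrow> is_sips r a \<alpha> (S r a \<alpha>)"
  using sips unfolding active_def valid_sips_choice_def by blast

lemma active_adorned:
  assumes "active r a \<alpha>" "q \<in> atoms r" "adorned_rule P S r a \<alpha> q = Some \<beta>"
  shows "(sym q, \<beta>) \<in> adorned_preds Q P S" "length \<beta> = length (args q)"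
proof -
  show "(sym q, \<beta>) \<in> adorned_preds Q P S"
    using assms adorned_preds.step[of "sym a" \<alpha> Q P S r a q \<beta>] unfolding active_def pred_def by simp
  show "length \<beta> = length (args q)"
    using assms unfolding active_def adorned_rule_def by (auto split: prod.splits if_splits)
qed

lemma adorned_head [simp]: "adorned_rule P S r a \<alpha> a = Some \<alpha>"
  unfolding adorned_rule_def by (auto split: prod.splits)

lemma adorned_None: "adorned_rule P S r a \<alpha> q = None \<Longrightarrow> edb P (pred q)"
  unfolding adorned_rule_def by (auto split: prod.splits if_splits)

text \<open>Other head atoms and negative atoms precede nothing, so magic rule bodies contain,
  besides the magic atom, only positive body atoms.\<close>

lemma preceding_pos_body:
  assumes "active r a \<alpha>" "(b, q) \<in> fst (S r a \<alpha>)" "b \<noteq> a"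
  shows "b \<in> pos_body r"
  using active_sips[OF assms(1)] assms(2,3) unfolding is_sips_def atoms_def
  by (auto split: prod.splits)

lemma sips_wf: "active r a \<alpha> \<Longrightarrow> wf (fst (S r a \<alpha>))"
proof -
  assume act: "active r a \<alpha>"
  have "finite (atoms r)"
    using act program unfolding active_def is_program_def is_rule_def atoms_def by auto
  moreover have "fst (S r a \<alpha>) \<subseteq> atoms r \<times> atoms r" "irrefl (fst (S r a \<alpha>))"
    "trans (fst (S r a \<alpha>))"
    using active_sips[OF act] unfolding is_sips_def by (auto split: prod.splits)
  ultimately show ?thesis
    by (intro finite_acyclic_wf) (auto simp: acyclic_irrefl elim: finite_subset)
qed

text \<open>An atom left without adornment is EDB and hence relevant anyway; an adorned one is
  relevant through its magic version.\<close>

lemma relevantI: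
  assumes "active r a \<alpha>" "q \<in> atoms r"
    and "\<And>\<beta>. adorned_rule P S r a \<alpha> q = Some \<beta> \<Longrightarrow> magic \<beta> (subst_atom \<sigma> q) \<in> X"
  shows "subst_atom \<sigma> q \<in> relevant X"
proof -
  have "base_atom q" using assms base_atoms unfolding active_def by blast
  then show ?thesis
    using assms active_adorned[OF assms(1,2)] adorned_None[of r a \<alpha> q] unfolding relevant_def
    by (cases "adorned_rule P S r a \<alpha> q") auto
qed

text \<open>Induction along the SIPS order: the predecessors of \<open>q\<close> are relevant by the
  induction hypothesis, hence true by the last assumption, so the magic rule for \<open>q\<close>
  fires. That assumption is limited to predecessors of \<open>q\<close> because nothing more is
  available in the induction over \<open>magic_closure\<close>.\<close>

lemma magic_passed:
  assumes act: "active r a \<alpha>" and \<sigma>: "range \<sigma> \<subseteq> U" and closed: "magic_closed X"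
    and start: "magic \<alpha> (subst_atom \<sigma> a) \<in> X"
    and "q \<in> atoms r" "adorned_rule P S r a \<alpha> q = Some \<beta>"
    and "\<And>b. b \<in> pos_body r \<Longrightarrow> b \<noteq> a \<Longrightarrow> (b, q) \<in> fst (S r a \<alpha>) \<Longrightarrow>
      subst_atom \<sigma> b \<in> relevant X \<Longrightarrow> subst_atom \<sigma> b \<in> X"
  shows "magic \<beta> (subst_atom \<sigma> q) \<in> X"
  using assms(5-7)
proof (induction q arbitrary: \<beta> rule: wf_induct_rule[OF sips_wf[OF act]])
  case (1 q)
  show ?case
  proof (cases "q = a")
    case True
    then show ?thesis using start "1.prems"(2) by simp
  next
    case False
    have "subst_atom \<sigma> b \<in> X" if b: "b \<in> atoms r - {a}" "(b, q) \<in> fst (S r a \<alpha>)" for b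
    proof -
      have pos: "b \<in> pos_body r" using preceding_pos_body[OF act b(2)] b(1) by blast
      \<comment> \<open>Transitivity makes the predecessors of \<open>b\<close> predecessors of
        \<open>q\<close>, so the last assumption passes down to \<open>b\<close>.\<close>
      have "trans (fst (S r a \<alpha>))"
        using active_sips[OF act] unfolding is_sips_def by (auto split: prod.splits)
      then have "subst_atom \<sigma> c \<in> X" if "c \<in> pos_body r" "c \<noteq> a" "(c, b) \<in> fst (S r a \<alpha>)"
        "subst_atom \<sigma> c \<in> relevant X" for c
        using that b(2) "1.prems"(3) by (meson transD)
      then have "subst_atom \<sigma> b \<in> relevant X"
        using b by (intro relevantI[OF act]) (auto intro: "1.IH")
      then show ?thesis using "1.prems"(3) b pos by blast
    qed
    then show ?thesis
      using closed act "1.prems"(1,2) False \<sigma> start unfolding magic_closed_def by blast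
  qed
qed

lemma active_rule_passed:
  assumes "active r a \<alpha>" "range \<sigma> \<subseteq> U" "magic_closed X" "magic \<alpha> (subst_atom \<sigma> a) \<in> X"
    and "\<And>b. b \<in> pos_body r \<Longrightarrow> subst_atom \<sigma> b \<in> relevant X \<Longrightarrow> subst_atom \<sigma> b \<in> X"
  shows "q \<in> atoms r \<Longrightarrow> adorned_rule P S r a \<alpha> q = Some \<beta> \<Longrightarrow> magic \<beta> (subst_atom \<sigma> q) \<in> X"
    and "q \<in> atoms r \<Longrightarrow> subst_atom \<sigma> q \<in> relevant X"
proof -
  have *: "magic \<beta> (subst_atom \<sigma> q) \<in> X"
    if "q \<in> atoms r" "adorned_rule P S r a \<alpha> q = Some \<beta>" for q \<beta>
    by (rule magic_passed[OF assms(1-4) that]) (rule assms(5))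
  show "q \<in> atoms r \<Longrightarrow> adorned_rule P S r a \<alpha> q = Some \<beta> \<Longrightarrow> magic \<beta> (subst_atom \<sigma> q) \<in> X"
    by (rule *)
  show "q \<in> atoms r \<Longrightarrow> subst_atom \<sigma> q \<in> relevant X"
    by (rule relevantI[OF assms(1) _ *])
qed

text \<open>The common core of both directions. A rule with an EDB head atom is a fact kept by the
  rewriting. Otherwise the adornment witnessing relevance of the head makes the rule active; all its
  atoms become relevant, so the whole positive body and all magic atoms of the modified rule hold in
  \<open>X\<close>.\<close>

lemma rule_fires:
  assumes model: "models U (DMS S Q P \<union> F) M X"
    and r: "r \<in> P" "range \<sigma> \<subseteq> U" "h \<in> head r" "subst_atom \<sigma> h \<in> relevant X"
    and pos: "\<And>b. b \<in> pos_body r \<Longrightarrow> subst_atom \<sigma> b \<in> relevant X \<Longrightarrow> subst_atom \<sigma> b \<in> X"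
    and neg: "\<And>b. b \<in> neg_body r \<Longrightarrow> subst_atom \<sigma> b \<notin> M"
  obtains h' where "h' \<in> head r" "subst_atom \<sigma> h' \<in> X" "subst_atom \<sigma> h' \<in> relevant X"
proof (cases "edb P (pred h)")
  case True
  note e = edb_head[OF r(1,3) True]
  have "head r \<subseteq> X" using model e(3) unfolding models_DMS by blast
  then have "subst_atom \<sigma> h \<in> X" using r(3) e(2) by (simp add: subst_atom_ground subset_iff)
  then show thesis using that r(3,4) by blast
next
  case False
  then obtain \<alpha> where \<alpha>: "active r h \<alpha>" "magic \<alpha> (subst_atom \<sigma> h) \<in> X"
    using r unfolding relevant_def active_def by auto
  have closed: "magic_closed X" and modified: "models_modified M X"
    using model unfolding models_DMS by auto
  note passed = active_rule_passed[OF \<alpha>(1) r(2) closed \<alpha>(2) pos]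
  have "subst_atom \<sigma> b \<in> X" if "b \<in> pos_body r" for b
    using pos[OF that] passed(2)[of b] that unfolding atoms_def by blast
  moreover have "magic \<gamma> (subst_atom \<sigma> h') \<in> X"
    if "h' \<in> head r" "adorned_rule P S r h \<alpha> h' = Some \<gamma>" for h' \<gamma>
    using passed(1)[of h' \<gamma>] that unfolding atoms_def by blast
  ultimately obtain h' where "h' \<in> head r" "subst_atom \<sigma> h' \<in> X"
    using modified \<alpha>(1) r(2) neg unfolding models_modified_def by blast
  then show thesis using that passed(2)[of h'] unfolding atoms_def by blast
qed

lemma models_P_facts:
  assumes "models U (P \<union> F) M N" "r \<in> EDB P \<union> F" shows "head r \<subseteq> N"
proof -
  have "models U (EDB P \<union> F) M N"
    using assms(1) by (rule models_mono) (auto simp: EDB_def)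
  moreover have "\<forall>r \<in> EDB P \<union> F. is_fact r"
    using EDB_facts(1) fact_set unfolding fact_set_def by auto
  ultimately show ?thesis using models_facts_iff[OF _ U_nonempty] assms(2) by blast
qed

text \<open>The seed is ground, and it is the magic version of every instance of the query at
  once.\<close>

lemma query_relevant:
  assumes "models U (DMS S Q P \<union> F) M X" shows "subst_atom \<theta> Q \<in> relevant X"
proof -
  have "magic (query_adornment Q) (subst_atom \<theta> Q) \<in> X"
    using assms atom_vars_seed[of Q] unfolding models_DMS subst_magic[symmetric]
    by (simp add: subst_atom_ground)
  then show ?thesis using base_query adorned_preds.seed[of Q P S]
    unfolding relevant_def query_adornment_def by auto
qed

lemma models_P_F_iff:
  "models U (P \<union> F) M N \<longleftrightarrow> models U P M N \<and> (\<forall>r\<in>F. head r \<subseteq> N)"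
  using models_Un[of U P F M N] models_facts_iff[of F U M N] fact_set U_nonempty
  unfolding fact_set_def by simp

lemma subst_base:
  assumes "r \<in> P" shows "b \<in> pos_body r \<Longrightarrow> base_atom (subst_atom \<sigma> b)"
    "b \<in> neg_body r \<Longrightarrow> base_atom (subst_atom \<sigma> b)" "b \<in> head r \<Longrightarrow> base_atom (subst_atom \<sigma> b)"
  using base_atoms[OF assms] unfolding atoms_def by auto

lemma relevant_base: "a \<in> relevant X \<Longrightarrow> base_atom a"
  unfolding relevant_def by simp

section \<open>From the rewritten to the original program\<close>

text \<open>The relevant atoms outside \<open>M'\<close> form an unfounded set, so \<open>M\<close>, which is forced to contain
  \<open>M'\<close>, agrees with \<open>M'\<close> on all relevant atoms.\<close>

lemma killed_atoms_unfounded: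
  assumes M': "stable U (DMS S Q P \<union> F) M'"
    and F': "F' = (\<lambda>a. Rule {a} {} {}) ` {a \<in> M'. base_atom a}" "\<forall>r\<in>F'. is_fact r"
    and M: "stable U (P \<union> F \<union> F') M"
  shows "M \<inter> relevant M' = M' \<inter> relevant M'"
proof -
  define K where "K = relevant M' - M'"
  have DM': "models U (DMS S Q P \<union> F) M' M'" using M' unfolding stable_def by simp
  have MM: "models U (P \<union> F \<union> F') M M" using M unfolding stable_def by simp
  then have PM: "models U P M M" and FM: "\<forall>r\<in>F. head r \<subseteq> M" and F'M: "\<forall>r\<in>F'. head r \<subseteq> M"
    using models_facts_iff[OF F'(2) U_nonempty, of M M]
    by (simp_all add: models_Un[of U "P \<union> F" F'] models_P_F_iff)
  have sub: "a \<in> M" if "a \<in> M'" "base_atom a" for a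
    using that F'M F'(1) by auto
  have "models U P M (M - K)"
  proof (rule modelsI)
    fix r \<sigma>
    assume r: "r \<in> P" "range \<sigma> \<subseteq> U" and pos: "subst_atom \<sigma> ` pos_body r \<subseteq> M - K"
      and neg: "subst_atom \<sigma> ` neg_body r \<inter> M = {}"
    from pos have "subst_atom \<sigma> ` pos_body r \<subseteq> M" by auto
    with PM r neg obtain h where h: "h \<in> head r" "subst_atom \<sigma> h \<in> M" by (elim modelsD)
    show "\<exists>h\<in>head r. subst_atom \<sigma> h \<in> M - K"
    proof (cases "subst_atom \<sigma> h \<in> K")
      \<comment> \<open>The original rule chose a head atom from \<open>K\<close>. Its modified
        version fires in \<open>M'\<close> and supplies another head atom, which lies in
        \<open>M'\<close> and so survives the removal of \<open>K\<close>.\<close>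
      case True
      then have "subst_atom \<sigma> h \<in> relevant M'" unfolding K_def by simp
      moreover have "subst_atom \<sigma> b \<in> M'" if "b \<in> pos_body r" "subst_atom \<sigma> b \<in> relevant M'" for b
        using that pos unfolding K_def by auto
      moreover have "subst_atom \<sigma> b \<notin> M'" if "b \<in> neg_body r" for b
        using that neg sub[OF _ subst_base(2)[OF r(1) that]] by auto
      ultimately obtain h' where h': "h' \<in> head r" "subst_atom \<sigma> h' \<in> M'"
        using rule_fires[OF DM' r h(1)] by metis
      then have "subst_atom \<sigma> h' \<in> M - K"
        using sub subst_base(3)[OF r(1)] unfolding K_def by simp
      then show ?thesis using h'(1) by auto
    qed (use h in auto)
  qed
  moreover have "\<forall>r\<in>F. head r \<subseteq> M - K"
    using DM' FM unfolding models_DMS K_def by blast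
  moreover have "\<forall>r\<in>F'. head r \<subseteq> M - K"
    using F'M F'(1) unfolding K_def by auto
  ultimately have "models U (P \<union> F \<union> F') M (M - K)"
    using models_facts_iff[OF F'(2) U_nonempty, of M "M - K"]
    by (simp add: models_Un[of U "P \<union> F" F'] models_P_F_iff)
  then have "M - K = M" by (rule stable_minimal[OF M Diff_subset])
  then show ?thesis using sub relevant_base unfolding K_def by blast
qed

text \<open>A model \<open>N\<close> of the smaller reduct below \<open>M\<close> must contain all
  base atoms of \<open>M'\<close>, by minimality of \<open>M'\<close>. Then \<open>N\<close> also
  satisfies the added facts, and minimality of \<open>M\<close> applies.\<close>

lemma stable_DMS_to_P:
  assumes M': "stable U (DMS S Q P \<union> F) M'"
    and F': "F' = (\<lambda>a. Rule {a} {} {}) ` {a \<in> M'. base_atom a}" "\<forall>r\<in>F'. is_fact r"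
    and M: "stable U (P \<union> F \<union> F') M"
  shows "stable U (P \<union> F) M"
proof -
  note agree = killed_atoms_unfounded[OF assms]
  have DM': "models U (DMS S Q P \<union> F) M' M'" using M' unfolding stable_def by simp
  then have closed: "magic_closed M'" and modified: "models_modified M' M'"
    and seed: "magic (query_adornment Q) Q \<in> M'"
    and factsM': "\<forall>r \<in> EDB P \<union> F. head r \<subseteq> M'"
    unfolding models_DMS by auto
  have "N = M" if "N \<subseteq> M" and N: "models U (P \<union> F) M N" for N
  proof -
    \<comment> \<open>All magic atoms of \<open>M'\<close> are kept and only base atoms are cut down
      to \<open>N\<close>; magic rules then stay satisfied, as their heads are not base
      atoms.\<close>
    define N' where "N' = {a \<in> M'. base_atom a \<longrightarrow> a \<in> N}"
    have PN: "models U P M N" using N by (simp add: models_P_F_iff)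
    have "magic_closed N'"
      unfolding magic_closed_def
    proof (intro allI impI)
      fix r a \<alpha> q \<beta> \<sigma>
      assume "active r a \<alpha>" "q \<in> atoms r - {a}" "adorned_rule P S r a \<alpha> q = Some \<beta>"
        "range \<sigma> \<subseteq> U" "magic \<alpha> (subst_atom \<sigma> a) \<in> N'"
        "\<forall>b\<in>atoms r - {a}. (b, q) \<in> fst (S r a \<alpha>) \<longrightarrow> subst_atom \<sigma> b \<in> N'"
      then have "magic \<beta> (subst_atom \<sigma> q) \<in> M'"
        using closed unfolding magic_closed_def N'_def by (metis (no_types, lifting) mem_Collect_eq)
      then show "magic \<beta> (subst_atom \<sigma> q) \<in> N'" unfolding N'_def by simp
    qed
    moreover have "models_modified M' N'"
      unfolding models_modified_def
    proof (intro allI impI)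
      fix r a \<alpha> \<sigma>
      assume act: "active r a \<alpha>" and \<sigma>: "range \<sigma> \<subseteq> U"
        and pos: "\<forall>b\<in>pos_body r. subst_atom \<sigma> b \<in> N'"
        and magic: "\<forall>h\<in>head r. \<forall>\<gamma>. adorned_rule P S r a \<alpha> h = Some \<gamma> \<longrightarrow>
          magic \<gamma> (subst_atom \<sigma> h) \<in> N'"
        and neg: "\<forall>b\<in>neg_body r. subst_atom \<sigma> b \<notin> M'"
      have r: "r \<in> P" "a \<in> head r" using act unfolding active_def by auto
      have "magic \<alpha> (subst_atom \<sigma> a) \<in> M'"
        using magic r(2) adorned_head unfolding N'_def by simp
      moreover have "subst_atom \<sigma> b \<in> M'" if "b \<in> pos_body r" for b
        using pos that unfolding N'_def by simp
      ultimately have rel: "subst_atom \<sigma> q \<in> relevant M'" if "q \<in> atoms r" for q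
        using active_rule_passed(2)[OF act \<sigma> closed] that by simp
      \<comment> \<open>Every atom of the rule is relevant, and on relevant atoms \<open>M\<close>
        and \<open>M'\<close> agree; this moves the negative body from \<open>M'\<close> to
        \<open>M\<close>.\<close>
      have "subst_atom \<sigma> ` neg_body r \<inter> M = {}"
        using neg rel agree unfolding atoms_def by blast
      moreover have "subst_atom \<sigma> ` pos_body r \<subseteq> N"
        using pos subst_base(1)[OF r(1)] unfolding N'_def by auto
      ultimately obtain h where h: "h \<in> head r" "subst_atom \<sigma> h \<in> N"
        using PN r(1) \<sigma> by (elim modelsD)
      moreover have "h \<in> atoms r" using h(1) unfolding atoms_def by simp
      ultimately have "subst_atom \<sigma> h \<in> M'" using rel[of h] agree \<open>N \<subseteq> M\<close> by blast
      then show "\<exists>h\<in>head r. subst_atom \<sigma> h \<in> N'" using h unfolding N'_def by auto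
    qed
    moreover have "\<forall>r \<in> EDB P \<union> F. head r \<subseteq> N'"
      using factsM' models_P_facts[OF N] unfolding N'_def by blast
    ultimately have "models U (DMS S Q P \<union> F) M' N'"
      using seed unfolding models_DMS N'_def by simp
    moreover have "N' \<subseteq> M'" unfolding N'_def by auto
    ultimately have "N' = M'" by (intro stable_minimal[OF M'])
    then have "{a \<in> M'. base_atom a} \<subseteq> N" unfolding N'_def by blast
    then have "\<forall>r\<in>F'. head r \<subseteq> N" using F'(1) by auto
    then have "models U (P \<union> F \<union> F') M N"
      using N models_facts_iff[OF F'(2) U_nonempty] models_Un[of U "P \<union> F" F'] by metis
    then show "N = M" by (rule stable_minimal[OF M \<open>N \<subseteq> M\<close>])
  qed
  moreover have "models U (P \<union> F) M M"
    using M models_mono[of U "P \<union> F \<union> F'" M M "P \<union> F"] unfolding stable_def by simp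
  ultimately show ?thesis unfolding stable_def by (metis psubset_eq)
qed

section \<open>From the original to the rewritten program\<close>

text \<open>Body atoms are tested in the fixed set \<open>M\<close>, so only magic atoms are
  generated recursively. The clause \<open>fact\<close> accounts for atoms over non-base symbols
  supplied by \<open>F\<close>.\<close>

inductive_set magic_closure :: "('p psym, 'c, 'v) atom set \<Rightarrow> ('p psym, 'c, 'v) atom set"
  for M :: "('p psym, 'c, 'v) atom set" where
  seed: "magic (query_adornment Q) Q \<in> magic_closure M"
| fact: "r \<in> F \<Longrightarrow> a \<in> head r \<Longrightarrow> \<not> base_atom a \<Longrightarrow> a \<in> magic_closure M"
| rule: "active r a \<alpha> \<Longrightarrow> q \<in> atoms r \<Longrightarrow> adorned_rule P S r a \<alpha> q = Some \<beta> \<Longrightarrow>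
    range \<sigma> \<subseteq> U \<Longrightarrow> magic \<alpha> (subst_atom \<sigma> a) \<in> magic_closure M \<Longrightarrow>
    (\<And>b. b \<in> atoms r - {a} \<Longrightarrow> (b, q) \<in> fst (S r a \<alpha>) \<Longrightarrow> subst_atom \<sigma> b \<in> M) \<Longrightarrow>
    magic \<beta> (subst_atom \<sigma> q) \<in> magic_closure M"

lemma magic_closure_not_base: "a \<in> magic_closure M \<Longrightarrow> \<not> base_atom a"
  by (induction rule: magic_closure.induct) simp_all

definition relevant_part where
  "relevant_part M = (M \<inter> relevant (magic_closure M)) \<union> magic_closure M"

lemma magic_in_relevant_part [simp]:
  "magic \<alpha> a \<in> relevant_part M \<longleftrightarrow> magic \<alpha> a \<in> magic_closure M"
  unfolding relevant_part_def by (auto dest: relevant_base)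

lemma base_in_relevant_part:
  "base_atom a \<Longrightarrow> a \<in> relevant_part M \<longleftrightarrow> a \<in> M \<and> a \<in> relevant (magic_closure M)"
  unfolding relevant_part_def by (auto dest: magic_closure_not_base)

lemma relevant_relevant_part: "relevant (relevant_part M) = relevant (magic_closure M)"
  unfolding relevant_def by simp

text \<open>Once the magic atoms and the positive body of a modified rule hold, all atoms of the
  rule are relevant, so \<open>M\<close> and its relevant part agree on them and the original rule
  provides the head.\<close>

lemma relevant_part_models:
  assumes "models U (P \<union> F) M M"
  shows "models U (DMS S Q P \<union> F) (relevant_part M) (relevant_part M)"
proof -
  let ?M' = "relevant_part M"
  have PM: "models U P M M" using assms by (simp add: models_P_F_iff)
  have closed: "magic_closed ?M'"
    unfolding magic_closed_def
  proof (intro allI impI)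
    fix r a \<alpha> q \<beta> \<sigma>
    assume act: "active r a \<alpha>" and *: "q \<in> atoms r - {a}" "adorned_rule P S r a \<alpha> q = Some \<beta>"
      "range \<sigma> \<subseteq> U" "magic \<alpha> (subst_atom \<sigma> a) \<in> ?M'"
      and body: "\<forall>b\<in>atoms r - {a}. (b, q) \<in> fst (S r a \<alpha>) \<longrightarrow> subst_atom \<sigma> b \<in> ?M'"
    have "subst_atom \<sigma> b \<in> M" if "b \<in> atoms r - {a}" "(b, q) \<in> fst (S r a \<alpha>)" for b
      using body that base_atoms[of r b] act base_in_relevant_part[of "subst_atom \<sigma> b" M]
      unfolding active_def by auto
    then show "magic \<beta> (subst_atom \<sigma> q) \<in> ?M'"
      using act * magic_closure.rule[of r a \<alpha> q \<beta> \<sigma> M] by simp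
  qed
  have "models_modified ?M' ?M'"
    unfolding models_modified_def
  proof (intro allI impI)
    fix r a \<alpha> \<sigma>
    assume act: "active r a \<alpha>" and \<sigma>: "range \<sigma> \<subseteq> U"
      and pos: "\<forall>b\<in>pos_body r. subst_atom \<sigma> b \<in> ?M'"
      and magic: "\<forall>h\<in>head r. \<forall>\<gamma>. adorned_rule P S r a \<alpha> h = Some \<gamma> \<longrightarrow>
        magic \<gamma> (subst_atom \<sigma> h) \<in> ?M'"
      and neg: "\<forall>b\<in>neg_body r. subst_atom \<sigma> b \<notin> ?M'"
    have r: "r \<in> P" "a \<in> head r" using act unfolding active_def by auto
    have "magic \<alpha> (subst_atom \<sigma> a) \<in> ?M'" using magic r(2) adorned_head by blast
    then have rel: "subst_atom \<sigma> q \<in> relevant (magic_closure M)" if "q \<in> atoms r" for q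
      using active_rule_passed(2)[OF act \<sigma> closed] that pos
      unfolding relevant_relevant_part by simp
    have "subst_atom \<sigma> b \<notin> M" if "b \<in> neg_body r" for b
      using neg rel[of b] that subst_base(2)[OF r(1) that, of \<sigma>]
        base_in_relevant_part[of "subst_atom \<sigma> b" M]
      unfolding atoms_def by auto
    then have "subst_atom \<sigma> ` neg_body r \<inter> M = {}" by auto
    moreover have "subst_atom \<sigma> ` pos_body r \<subseteq> M"
      using pos subst_base(1)[OF r(1)] base_in_relevant_part by auto
    ultimately obtain h where h: "h \<in> head r" "subst_atom \<sigma> h \<in> M"
      using PM r(1) \<sigma> by (elim modelsD)
    then have "subst_atom \<sigma> h \<in> ?M'"
      using rel[of h] unfolding atoms_def relevant_part_def by simp
    then show "\<exists>h\<in>head r. subst_atom \<sigma> h \<in> ?M'" using h(1) by auto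
  qed
  moreover have "head r \<subseteq> ?M'" if r: "r \<in> EDB P \<union> F" for r
  proof
    fix a assume a: "a \<in> head r"
    have "a \<in> M" using models_P_facts[OF assms r] a by auto
    moreover have "edb P (pred a)" using r a EDB_facts(2) edb_facts by auto
    moreover have "a \<in> magic_closure M" if "\<not> base_atom a"
    proof -
      have "r \<notin> EDB P" using that a base_atoms[of r a] unfolding EDB_def atoms_def by auto
      then show ?thesis using r a that magic_closure.fact by blast
    qed
    ultimately show "a \<in> ?M'" unfolding relevant_part_def relevant_def by auto
  qed
  ultimately show ?thesis using closed magic_closure.seed unfolding models_DMS by auto
qed

text \<open>A smaller model \<open>N\<close> could lose both base and magic atoms. Minimality of
  \<open>M\<close> first restores the base atoms relevant in \<open>N\<close>; induction over
  \<open>magic_closure\<close> then restores the magic atoms, and with them the full set of relevant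
  atoms.\<close>

lemma stable_P_to_DMS:
  assumes M: "stable U (P \<union> F) M"
  shows "stable U (DMS S Q P \<union> F) (relevant_part M)"
proof -
  let ?M' = "relevant_part M"
  have PFM: "models U (P \<union> F) M M" using M unfolding stable_def by simp
  then have PM: "models U P M M" by (simp add: models_P_F_iff)
  have "N = ?M'" if "N \<subseteq> ?M'" and N: "models U (DMS S Q P \<union> F) ?M' N" for N
  proof -
    have closed: "magic_closed N" using N unfolding models_DMS by simp
    \<comment> \<open>Relevance is measured in \<open>N\<close> itself, so that
      \<open>rule_fires\<close> applies with the magic atoms that \<open>N\<close> still
      has.\<close>
    define N' where "N' = (N \<inter> relevant N) \<union> (M - relevant N)"
    have NM: "a \<in> M" if "a \<in> N" "a \<in> relevant N" for a
      using that \<open>N \<subseteq> ?M'\<close> relevant_base base_in_relevant_part by blast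
    have "models U P M N'"
    proof (rule modelsI)
      fix r \<sigma>
      assume r: "r \<in> P" "range \<sigma> \<subseteq> U" and pos: "subst_atom \<sigma> ` pos_body r \<subseteq> N'"
        and neg: "subst_atom \<sigma> ` neg_body r \<inter> M = {}"
      have "subst_atom \<sigma> ` pos_body r \<subseteq> M" using pos NM unfolding N'_def by auto
      with PM r neg obtain h where h: "h \<in> head r" "subst_atom \<sigma> h \<in> M" by (elim modelsD)
      show "\<exists>h\<in>head r. subst_atom \<sigma> h \<in> N'"
      proof (cases "subst_atom \<sigma> h \<in> relevant N")
        case True
        have "subst_atom \<sigma> b \<in> N" if "b \<in> pos_body r" "subst_atom \<sigma> b \<in> relevant N" for b
          using that pos unfolding N'_def by auto
        moreover have "subst_atom \<sigma> b \<notin> ?M'" if "b \<in> neg_body r" for b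
          using that neg subst_base(2)[OF r(1) that] base_in_relevant_part by auto
        ultimately obtain h' where "h' \<in> head r" "subst_atom \<sigma> h' \<in> N" "subst_atom \<sigma> h' \<in> relevant N"
          using rule_fires[OF N r h(1) True] by metis
        then show ?thesis unfolding N'_def by auto
      qed (use h N'_def in auto)
    qed
    moreover have "\<forall>r\<in>F. head r \<subseteq> N'"
    proof (intro ballI subsetI)
      fix r a assume "r \<in> F" "a \<in> head r"
      then have "a \<in> N" "a \<in> M" using N models_P_facts[OF PFM, of r] unfolding models_DMS by auto
      then show "a \<in> N'" unfolding N'_def by simp
    qed
    ultimately have "models U (P \<union> F) M N'" by (simp add: models_P_F_iff)
    moreover have "N' \<subseteq> M" using NM unfolding N'_def by auto
    ultimately have "N' = M" by (intro stable_minimal[OF M])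
    then have MN: "a \<in> N" if "a \<in> M" "a \<in> relevant N" for a
      using that unfolding N'_def by auto
    have "a \<in> N" if "a \<in> magic_closure M" for a
      using that
    proof (induction rule: magic_closure.induct)
      case seed
      then show ?case using N unfolding models_DMS by simp
    next
      case (fact r a)
      then show ?case using N unfolding models_DMS by auto
    next
      case (rule r a \<alpha> q \<beta> \<sigma>)
      \<comment> \<open>The closure rule knows the predecessors of \<open>q\<close> to be true in
        \<open>M\<close>; those relevant in \<open>N\<close> therefore lie in
        \<open>N\<close>.\<close>
      have "subst_atom \<sigma> b \<in> N"
        if "b \<in> pos_body r" "b \<noteq> a" "(b, q) \<in> fst (S r a \<alpha>)" "subst_atom \<sigma> b \<in> relevant N" for b
        using that MN rule.hyps(6) unfolding atoms_def by auto
      then show ?case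
        using magic_passed[OF rule.hyps(1,4) closed rule.IH rule.hyps(2,3)] by simp
    qed
    moreover from this have "relevant (magic_closure M) \<subseteq> relevant N"
      unfolding relevant_def by auto
    ultimately have "?M' \<subseteq> N" using MN unfolding relevant_part_def by auto
    then show ?thesis using \<open>N \<subseteq> ?M'\<close> by auto
  qed
  then show ?thesis using relevant_part_models[OF PFM] unfolding stable_def by (metis psubset_eq)
qed

section \<open>Constants and safety of the rewritten program\<close>

lemma DMS_cases:
  assumes "r' \<in> DMS S Q P"
  obtains (modified) r a \<alpha> where "active r a \<alpha>" "r' = modified_rule P S r a \<alpha>"
  | (magic) r a \<alpha> where "active r a \<alpha>" "r' \<in> magic_rules P S r a \<alpha>"
  | (seed) "r' = Rule {magic (query_adornment Q) Q} {} {}"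
  | (edb) "r' \<in> EDB P"
  using assms unfolding DMS_eq by auto

lemma DMS_atoms:
  assumes "r' \<in> DMS S Q P" "a \<in> atoms r'"
  shows "a = magic (query_adornment Q) Q \<or> (\<exists>r\<in>P. \<exists>b\<in>atoms r. a = b \<or> (\<exists>\<gamma>. a = magic \<gamma> b))"
  using assms(1)
proof (cases rule: DMS_cases)
  case (modified r b \<alpha>)
  then show ?thesis
    using assms(2) unfolding active_def modified_rule_def atoms_def by auto
next
  case (magic r b \<alpha>)
  then have "r \<in> P" "b \<in> atoms r" unfolding active_def atoms_def by auto
  moreover have "a \<in> atoms r \<or> (\<exists>c\<in>atoms r. \<exists>\<gamma>. a = magic \<gamma> c)"
    using magic(2) assms(2) \<open>b \<in> atoms r\<close> unfolding magic_rules_def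
    by (auto simp: atoms_def[of "Rule _ _ _"])
  ultimately show ?thesis by blast
next
  case seed
  then show ?thesis using assms(2) unfolding atoms_def by simp
next
  case edb
  then show ?thesis using assms(2) unfolding EDB_def by auto
qed

text \<open>Magic atoms only drop arguments. The constants of the seed come from the query, whence
  the condition on \<open>Q\<close>.\<close>

lemma prog_consts_DMS:
  assumes "atom_consts Q \<subseteq> prog_consts P"
  shows "prog_consts (DMS S Q P) \<subseteq> prog_consts P"
proof -
  have "atom_consts a \<subseteq> prog_consts P" if "r' \<in> DMS S Q P" "a \<in> atoms r'" for r' a
    using DMS_atoms[OF that]
  proof (elim disjE bexE exE)
    assume "a = magic (query_adornment Q) Q"
    then show ?thesis using assms atom_consts_magic[of _ Q] by blast
  next
    fix r b assume "r \<in> P" "b \<in> atoms r" "a = b"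
    then show ?thesis unfolding prog_consts_def by blast
  next
    fix r b \<gamma> assume "r \<in> P" "b \<in> atoms r" "a = magic \<gamma> b"
    then show ?thesis using atom_consts_magic[of \<gamma> b] unfolding prog_consts_def by blast
  qed
  then show ?thesis unfolding prog_consts_def[of "DMS S Q P"] by blast
qed

text \<open>A variable kept in the magic head was bound either by the adornment of \<open>a\<close>,
  hence occurs in \<open>magic \<alpha> a\<close>, or by a preceding positive atom, which is in the
  body of the magic rule.\<close>

lemma magic_rule_safe:
  assumes act: "active r a \<alpha>" and q: "q \<in> atoms r - {a}" "adorned_rule P S r a \<alpha> q = Some \<beta>"
  shows "atom_vars (magic \<beta> q) \<subseteq> (\<Union>b \<in> {magic \<alpha> a} \<union> {b \<in> atoms r - {a}. (b, q) \<in> fst (S r a \<alpha>)}. atom_vars b)"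
proof
  fix x assume x: "x \<in> atom_vars (magic \<beta> q)"
  obtain prec f where S: "S r a \<alpha> = (prec, f)" by (cases "S r a \<alpha>")
  have f: "f a = atom_vars (magic \<alpha> a)" "\<And>b. b \<in> atoms r \<Longrightarrow> f b \<subseteq> atom_vars b"
    using active_sips[OF act] S unfolding is_sips_def atom_vars_def magic_def by auto
  have \<beta>: "\<beta> = map (binding_of (f a \<union> (\<Union>b \<in> {b \<in> pos_body r. (b, q) \<in> prec}. f b))) (args q)"
    using q S unfolding adorned_rule_def by (auto split: if_splits)
  have "Var x \<in> set (bound_args \<beta> (args q))" using x unfolding atom_vars_def magic_def by simp
  then have "x \<in> f a \<union> (\<Union>b \<in> {b \<in> pos_body r. (b, q) \<in> prec}. f b)"
    unfolding \<beta> by (rule bound_args_binding)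
  then consider "x \<in> f a" | b where "b \<in> pos_body r" "b \<noteq> a" "(b, q) \<in> prec" "x \<in> f b"
    by auto
  then show "x \<in> (\<Union>b \<in> {magic \<alpha> a} \<union> {b \<in> atoms r - {a}. (b, q) \<in> fst (S r a \<alpha>)}. atom_vars b)"
  proof cases
    case 1
    then show ?thesis using f(1) by simp
  next
    case (2 b)
    moreover from this have "b \<in> atoms r" unfolding atoms_def by simp
    ultimately show ?thesis using f(2)[of b] S by auto
  qed
qed

lemma safe_DMS:
  assumes "safe_program P" shows "safe_program (DMS S Q P)"
  unfolding safe_program_def
proof (intro ballI)
  fix r' c assume "r' \<in> DMS S Q P" and c: "c \<in> atoms r'"
  from this(1) show "atom_vars c \<subseteq> (\<Union>b\<in>pos_body r'. atom_vars b)"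
  proof (cases rule: DMS_cases)
    case (modified r a \<alpha>)
    then have r: "r \<in> P" unfolding active_def by simp
    have "atom_vars b \<subseteq> (\<Union>b\<in>pos_body r. atom_vars b)" if "b \<in> atoms r" for b
      using assms that r unfolding safe_program_def by blast
    moreover have "\<exists>b\<in>atoms r. atom_vars c \<subseteq> atom_vars b"
    proof (cases "c \<in> atoms r")
      case False
      then obtain h \<gamma> where "h \<in> head r" "c = magic \<gamma> h"
        using c modified(2) unfolding modified_rule_def atoms_def by auto
      then show ?thesis using atom_vars_magic[of \<gamma> h] unfolding atoms_def by auto
    qed auto
    moreover have "pos_body r \<subseteq> pos_body r'" using modified(2) unfolding modified_rule_def by simp
    ultimately show ?thesis by blast
  next
    case (magic r a \<alpha>)
    then obtain q \<beta> where q: "q \<in> atoms r - {a}" "adorned_rule P S r a \<alpha> q = Some \<beta>"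
      and r': "r' = Rule {magic \<beta> q}
        ({magic \<alpha> a} \<union> {b \<in> atoms r - {a}. (b, q) \<in> fst (S r a \<alpha>)}) {}"
      unfolding magic_rules_def by blast
    from c r' have "c = magic \<beta> q \<or> c \<in> pos_body r'" unfolding atoms_def by auto
    then show ?thesis using magic_rule_safe[OF magic(1) q] r' by auto
  next
    case seed
    then show ?thesis using c atom_vars_seed[of Q] unfolding atoms_def by simp
  next
    case edb
    then have "r' \<in> P" unfolding EDB_def by simp
    then show ?thesis using assms c unfolding safe_program_def by blast
  qed
qed

section \<open>Transfer to answer sets of the two programs\<close>

lemma stable_DMS_base:
  assumes M': "stable U (DMS S Q P \<union> F) M'" and U: "U = universe (P \<union> F)"
  shows "{a \<in> M'. base_atom a} \<subseteq> herbrand_base (P \<union> F)"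
proof
  fix a assume "a \<in> {a \<in> M'. base_atom a}"
  then have "a \<in> M'" "base_atom a" by auto
  obtain r' \<sigma> h where *: "r' \<in> DMS S Q P \<union> F" "range \<sigma> \<subseteq> U" "h \<in> head r'" "a = subst_atom \<sigma> h"
    using stable_supported[OF M' \<open>a \<in> M'\<close>] by metis
  then have h: "h \<in> atoms r'" "base_atom h" using \<open>base_atom a\<close> unfolding atoms_def by auto
  \<comment> \<open>Magic atoms are not base atoms, so a base head atom of the rewriting already
    occurs in \<open>P\<close>.\<close>
  obtain r where "r \<in> P \<union> F" "h \<in> atoms r"
  proof (cases "r' \<in> F")
    case False
    then have "r' \<in> DMS S Q P" using *(1) by simp
    then show thesis using DMS_atoms[OF _ h(1)] h(2) that by auto
  qed (use h that in auto)
  then show "a \<in> herbrand_base (P \<union> F)"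
    using subst_in_herbrand_base *(2,4) U by metis
qed

text \<open>The only use of super-consistency: it supplies an answer set after the base atoms of
  \<open>M'\<close> have been added as facts, and \<open>stable_DMS_to_P\<close> drops these facts
  again.\<close>

lemma stable_extension_exists:
  assumes M': "stable U (DMS S Q P \<union> F) M'" and U: "U = universe (P \<union> F)"
    and super: "super_consistent P"
  obtains M where "stable U (P \<union> F) M" "M \<inter> relevant M' = M' \<inter> relevant M'"
proof -
  define F' :: "('p psym, 'c, 'v) program"
    where "F' = (\<lambda>a. Rule {a} {} {}) ` {a \<in> M'. base_atom a}"
  note base = stable_DMS_base[OF M' U]
  have "is_program (P \<union> F)"
    using program fact_set unfolding is_program_def fact_set_def
    by (auto simp: is_rule_def elim!: is_fact_cases)
  then have "finite F'"
    using finite_subset[OF base finite_herbrand_base] unfolding F'_def by simp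
  have args: "set (args a) \<subseteq> Cst ` U" if "a \<in> M'" "base_atom a" for a
    using base that U unfolding herbrand_base_def by auto
  then have fact: "\<forall>r\<in>F'. is_fact r"
    using atom_vars_empty_if_args unfolding F'_def is_fact_def by fastforce
  have "prog_consts F' \<subseteq> U"
    using args unfolding F'_def prog_consts_def atom_consts_def atoms_def by fastforce
  \<comment> \<open>If \<open>P \<union> F\<close> has no constants, \<open>U\<close> consists of
    the default \<open>undefined\<close>; \<open>F'\<close> can then introduce no other constant, so
    the universe is the same in this case too.\<close>
  then have univ: "universe (P \<union> (F \<union> F')) = U"
    using U unfolding universe_def by (auto simp: prog_consts_Un split: if_splits)
  have "fact_set (F \<union> F')"
    using fact_set fact \<open>finite F'\<close> unfolding fact_set_def by auto
  then obtain M where "answer_set (P \<union> (F \<union> F')) M"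
    using super unfolding super_consistent_def by blast
  then have M: "stable U (P \<union> F \<union> F') M"
    unfolding answer_set_iff_stable univ by (simp add: Un_assoc)
  show thesis
    using that stable_DMS_to_P[OF M' F'_def fact M] killed_atoms_unfounded[OF M' F'_def fact M]
    by blast
qed

text \<open>The rewriting may lose constants. For safe programs the change of universe leaves stable
  models intact; in the other case both programs have the same constants and so the same
  universe.\<close>

lemma answer_set_DMS_iff:
  assumes U: "U = universe (P \<union> F)" and Q: "atom_consts Q \<subseteq> prog_consts P"
    and "safe_program P \<or> prog_consts P \<subseteq> prog_consts (DMS S Q P)"
  shows "answer_set (DMS S Q P \<union> F) M' \<longleftrightarrow> stable U (DMS S Q P \<union> F) M'"
  using assms(3)
proof
  assume "safe_program P"
  then have "safe_program (DMS S Q P)" by (rule safe_DMS)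
  moreover have "safe_program F"
    using fact_set unfolding safe_program_def fact_set_def
    by (auto simp: atoms_def elim!: is_fact_cases)
  ultimately have "safe_program (DMS S Q P \<union> F)" unfolding safe_program_def by (simp add: ball_Un)
  moreover have "prog_consts (DMS S Q P \<union> F) \<subseteq> U"
    using prog_consts_DMS[OF Q] prog_consts_subset_universe[of "P \<union> F"]
    unfolding U prog_consts_Un by blast
  ultimately show ?thesis
    unfolding answer_set_iff_stable
    using stable_safe_universe prog_consts_subset_universe universe_nonempty U_nonempty by metis
next
  assume "prog_consts P \<subseteq> prog_consts (DMS S Q P)"
  then have "prog_consts (DMS S Q P) = prog_consts P" using prog_consts_DMS[OF Q] by simp
  then show ?thesis
    unfolding answer_set_iff_stable U universe_def prog_consts_Un by simp
qed

end

theorem theorem2: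
  fixes P :: "('p psym, 'c, 'v) program"
    and Q :: "('p psym, 'c, 'v) atom"
    and S :: "('p psym, 'c, 'v) sips_choice"
  assumes "is_program P" and "super_consistent P"
    and "base_program P" and "base_atom Q"
    and "atom_consts Q \<subseteq> prog_consts P"
    and "valid_sips_choice P S"
    and "safe_program P \<or> prog_consts P \<subseteq> prog_consts (DMS S Q P)"
  shows "brave_equivalent Q P (DMS S Q P) \<and> cautious_equivalent Q P (DMS S Q P)"
proof -
  have "brave_answers Q (P \<union> F) = brave_answers Q (DMS S Q P \<union> F) \<and>
      cautious_answers Q (P \<union> F) = cautious_answers Q (DMS S Q P \<union> F)"
    if F: "common_edb_facts P (DMS S Q P) F" for F
  proof -
    define U where "U = universe (P \<union> F)"
    interpret magic_sets P Q S F U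
      using assms F universe_nonempty[of "P \<union> F"]
      by unfold_locales (auto simp: common_edb_facts_def U_def)
    note DMS_iff = answer_set_DMS_iff[OF U_def assms(5,7)]
    have P_iff: "answer_set (P \<union> F) M \<longleftrightarrow> stable U (P \<union> F) M" for M
      unfolding answer_set_iff_stable U_def ..
    \<comment> \<open>The matched answer set agrees on all instances of the query at once, which
      serves both the existential quantifier of brave answers and the universal one of cautious
      answers.\<close>
    have to_P: "\<exists>M. answer_set (P \<union> F) M \<and> (\<forall>\<theta>. subst_atom \<theta> Q \<in> M \<longleftrightarrow> subst_atom \<theta> Q \<in> M')"
      if "answer_set (DMS S Q P \<union> F) M'" for M'
    proof -
      have M': "stable U (DMS S Q P \<union> F) M'" using that DMS_iff by simp
      then have "subst_atom \<theta> Q \<in> relevant M'" for \<theta>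
        using query_relevant unfolding stable_def by blast
      moreover obtain M where "stable U (P \<union> F) M" "M \<inter> relevant M' = M' \<inter> relevant M'"
        using stable_extension_exists[OF M' U_def assms(2)] .
      ultimately show ?thesis unfolding P_iff by blast
    qed
    have to_DMS: "\<exists>M'. answer_set (DMS S Q P \<union> F) M' \<and>
        (\<forall>\<theta>. subst_atom \<theta> Q \<in> M \<longleftrightarrow> subst_atom \<theta> Q \<in> M')"
      if "answer_set (P \<union> F) M" for M
    proof -
      have M': "stable U (DMS S Q P \<union> F) (relevant_part M)"
        using that stable_P_to_DMS P_iff by simp
      then have "subst_atom \<theta> Q \<in> relevant (relevant_part M)" for \<theta>
        using query_relevant unfolding stable_def by blast
      then have "subst_atom \<theta> Q \<in> M \<longleftrightarrow> subst_atom \<theta> Q \<in> relevant_part M" for \<theta>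
        using base_in_relevant_part[of "subst_atom \<theta> Q" M] assms(4) relevant_relevant_part by simp
      then show ?thesis using M' DMS_iff by blast
    qed
    show ?thesis
      unfolding brave_answers_def cautious_answers_def using to_P to_DMS by (safe; metis)
  qed
  then show ?thesis unfolding brave_equivalent_def cautious_equivalent_def by blast
qed

end
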